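(* Let $V\subset\mathbb{R}^n$ be locally compact and let $f:V\times\mathbb{R}^m\to[0,\infty]$ be lower semicontinuous (jointly) in both variables and convex in the second variable, and such that $t\mapsto f(t,0)$ is locally bounded on $V$. Let $\nu\in\mathcal{M}(V,\mathbb{R}^{m+1})$ and let $(p^{\xi},p^{\lambda})\in L^1_{|\nu|}(V,\mathbb{R}^m\times\mathbb{R})$ denote the Radon-Nikodym density of $\nu$ with respect to its total variation $|\nu|$. Then $$\mathfrak{B}_f(\nu)=\int_V \tilde h_f\big(t,p^{\xi}(t),p^{\lambda}(t)\big)\,|\nu|(\mathrm{d}t).$$
   Context: $C_0(V,\mathbb{R}^k)$ is the closure, in the supremum norm, of the compactly supported continuous functions $V\to\mathbb{R}^k$; $\mathcal{M}(V,\mathbb{R}^k)$ is the space of (finite) $\mathbb{R}^k$-valued Radon measures on $V$, and $\langle\nu,\phi\rangle:=\int_V\langle\phi,\mathrm{d}\nu\rangle$. Locally compact means that every $t\in V$ has a compact neighborhood in $V$. The convex conjugate is taken in the last variable: $f^*(t,\xi):=\sup_{p\in\mathbb{R}^m}\langle\xi,p\rangle-f(t,p)$. The generalized Benamou-Brenier functional $\mathfrak{B}_f:\mathcal{M}(V,\mathbb{R}^{m+1})\to[-\infty,\infty]$ is $$\mathfrak{B}_f(\nu):=\sup_{\phi\in\mathcal{K}_f}\langle\nu,\phi\rangle,$$ $$\mathcal{K}_f:=\{(\phi^{\xi},\phi^{\lambda})\in C_0(V,\mathbb{R}^m\times\mathbb{R}) : f^*(t,\phi^{\xi}(t))+\phi^{\lambda}(t)\le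 0\ \ \forall t\in V\}.$$ The pointwise perspective function $\tilde h_f:V\times\mathbb{R}^m\times\mathbb{R}\to[0,\infty]$ is $$\tilde h_f(t,\xi,\lambda):=\begin{cases}\lambda f(t,\xi/\lambda),&\lambda>0,\\ \lim_{\rho\searrow0}\rho f(t,\xi/\rho),&\lambda=0,\\ +\infty,&\lambda<0.\end{cases}$$ *)

theory Defs
  imports "HOL-Analysis.Analysis"
begin

abbreviation borel_on :: "'a::topological_space set \<Rightarrow> 'a set set" where
  "borel_on V \<equiv> sets (restrict_space borel V)"

text \<open>
  A vector measure on \<open>V\<close> is a set function; its values outside \<open>borel_on V\<close> are irrelevant.
\<close>

definition vector_measure ::
    "'a::topological_space set \<Rightarrow> ('a set \<Rightarrow> 'b::real_normed_vector) \<Rightarrow> bool" where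
  "vector_measure V \<nu> \<longleftrightarrow>
     \<nu> {} = 0 \<and>
     (\<forall>E :: nat \<Rightarrow> 'a set. range E \<subseteq> borel_on V \<longrightarrow> disjoint_family E \<longrightarrow>
        (\<lambda>i. \<nu> (E i)) sums \<nu> (\<Union>i. E i))"

definition variation ::
    "'a::topological_space set \<Rightarrow> ('a set \<Rightarrow> 'b::real_normed_vector) \<Rightarrow> 'a set \<Rightarrow> ennreal" where
  "variation V \<nu> A =
     (SUP E \<in> {E :: nat \<Rightarrow> 'a set. range E \<subseteq> borel_on V \<and> disjoint_family E \<and> (\<Union>i. E i) = A}.
        \<Sum>i. ennreal (norm (\<nu> (E i))))"

definition total_variation ::
    "'a::topological_space set \<Rightarrow> ('a set \<Rightarrow> 'b::real_normed_vector) \<Rightarrow> 'a measure" where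
  "total_variation V \<nu> = measure_of V (borel_on V) (variation V \<nu>)"

text \<open>
  Inner regularity is automatic when \<open>V\<close> is a locally compact subset of a Euclidean space; it
  is stated because it belongs to the notion of a Radon measure.
\<close>

definition radon_measures ::
    "'a::topological_space set \<Rightarrow> ('a set \<Rightarrow> 'b::real_normed_vector) set" where
  "radon_measures V =
     {\<nu>. vector_measure V \<nu> \<and> variation V \<nu> V < \<infinity> \<and>
         (\<forall>A \<in> borel_on V. variation V \<nu> A = (SUP K \<in> {K. compact K \<and> K \<subseteq> A}. variation V \<nu> K))}"

definition polar_density ::
    "'a::topological_space set \<Rightarrow> ('a set \<Rightarrow> 'b::euclidean_space) \<Rightarrow> ('a \<Rightarrow> 'b) \<Rightarrow> bool" where
  "polar_density V \<nu> p \<longleftrightarrow>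
     integrable (total_variation V \<nu>) p \<and>
     (\<forall>A \<in> borel_on V. \<nu> A = (LINT t:A|total_variation V \<nu>. p t))"

text \<open>
  The positive part in the Jordan decomposition of a real measure; the negative part is the
  positive part of \<open>-\<mu>\<close>. Since \<open>ennreal\<close> sends negative reals to \<open>0\<close>, and \<open>{}\<close> is among
  the competitors, truncation does not change the supremum.
\<close>

definition jordan_pos :: "'a::topological_space set \<Rightarrow> ('a set \<Rightarrow> real) \<Rightarrow> 'a measure" where
  "jordan_pos V \<mu> =
     measure_of V (borel_on V) (\<lambda>A. SUP B \<in> {B \<in> borel_on V. B \<subseteq> A}. ennreal (\<mu> B))"

definition signed_integral ::
    "'a::topological_space set \<Rightarrow> ('a set \<Rightarrow> real) \<Rightarrow> ('a \<Rightarrow> real) \<Rightarrow> real" where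
  "signed_integral V \<mu> g =
     (LINT t|jordan_pos V \<mu>. g t) - (LINT t|jordan_pos V (\<lambda>A. - \<mu> A). g t)"

definition pairing ::
    "'a::topological_space set \<Rightarrow> ('a set \<Rightarrow> 'b::euclidean_space) \<Rightarrow> ('a \<Rightarrow> 'b) \<Rightarrow> real" where
  "pairing V \<nu> \<phi> = (\<Sum>b\<in>Basis. signed_integral V (\<lambda>A. \<nu> A \<bullet> b) (\<lambda>t. \<phi> t \<bullet> b))"

text \<open>Functions on \<open>V\<close> are total functions whose values outside \<open>V\<close> are irrelevant.\<close>

definition C_c :: "'a::topological_space set \<Rightarrow> ('a \<Rightarrow> 'b::real_normed_vector) set" where
  "C_c V = {\<psi>. continuous_on V \<psi> \<and> (\<exists>K. compact K \<and> K \<subseteq> V \<and> (\<forall>t \<in> V - K. \<psi> t = 0))}"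

definition C_0 :: "'a::topological_space set \<Rightarrow> ('a \<Rightarrow> 'b::real_normed_vector) set" where
  "C_0 V = {\<phi>. \<forall>\<epsilon>>0. \<exists>\<psi> \<in> C_c V. \<forall>t\<in>V. norm (\<phi> t - \<psi> t) \<le> \<epsilon>}"

definition lower_semicontinuous_on ::
    "'a::topological_space set \<Rightarrow> ('a \<Rightarrow> 'b::linorder) \<Rightarrow> bool" where
  "lower_semicontinuous_on S g \<longleftrightarrow>
     (\<forall>x\<in>S. \<forall>c < g x. eventually (\<lambda>y. c < g y) (at x within S))"

definition convex_ennreal :: "('a::real_vector \<Rightarrow> ennreal) \<Rightarrow> bool" where
  "convex_ennreal g \<longleftrightarrow>
     (\<forall>x y. \<forall>u\<ge>0. \<forall>v\<ge>0. u + v = 1 \<longrightarrow>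
        g (u *\<^sub>R x + v *\<^sub>R y) \<le> ennreal u * g x + ennreal v * g y)"

definition locally_bounded_on :: "'a::topological_space set \<Rightarrow> ('a \<Rightarrow> ennreal) \<Rightarrow> bool" where
  "locally_bounded_on V g \<longleftrightarrow>
     (\<forall>t\<in>V. \<exists>U C. open U \<and> t \<in> U \<and> (\<forall>s \<in> V \<inter> U. g s \<le> ennreal C))"

definition conjugate :: "('a \<Rightarrow> 'm::real_inner \<Rightarrow> ennreal) \<Rightarrow> 'a \<Rightarrow> 'm \<Rightarrow> ereal" where
  "conjugate f t \<xi> = (SUP p. ereal (\<xi> \<bullet> p) - enn2ereal (f t p))"

definition K_set ::
    "'a::topological_space set \<Rightarrow> ('a \<Rightarrow> 'm::euclidean_space \<Rightarrow> ennreal) \<Rightarrow> ('a \<Rightarrow> 'm \<times> real) set" where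
  "K_set V f = {\<phi> \<in> C_0 V. \<forall>t\<in>V. conjugate f t (fst (\<phi> t)) + ereal (snd (\<phi> t)) \<le> 0}"

definition benamou_brenier ::
    "'a::topological_space set \<Rightarrow> ('a \<Rightarrow> 'm::euclidean_space \<Rightarrow> ennreal) \<Rightarrow>
     ('a set \<Rightarrow> 'm \<times> real) \<Rightarrow> ereal" where
  "benamou_brenier V f \<nu> = (SUP \<phi> \<in> K_set V f. ereal (pairing V \<nu> \<phi>))"

definition perspective ::
    "('a \<Rightarrow> 'm::real_vector \<Rightarrow> ennreal) \<Rightarrow> 'a \<Rightarrow> 'm \<Rightarrow> real \<Rightarrow> ennreal" where
  "perspective f t \<xi> l =
     (if l > 0 then ennreal l * f t (\<xi> /\<^sub>R l)
      else if l = 0 then Lim (at_right 0) (\<lambda>\<rho>. ennreal \<rho> * f t (\<xi> /\<^sub>R \<rho>))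
      else \<infinity>)"

end

theory Submission
  imports Defs
begin

text \<open>
  Let \<open>G t\<close> be the closed convex set of all \<open>(a, b)\<close> with \<open>a \<bullet> p + b \<le> f t p\<close> for every \<open>p\<close>.  The
  admissible \<open>\<phi>\<close> are the \<open>C_0\<close> selections of \<open>G\<close>, and by Fenchel--Moreau duality the perspective of
  \<open>f t\<close> is the support function of \<open>G t\<close>; this gives one inequality pointwise.  For the other one, joint
  lower semicontinuity of \<open>f\<close> and local boundedness of \<open>f t 0\<close> make \<open>G\<close> inner semicontinuous, so
  Michael's selection argument produces an admissible \<open>\<phi>\<close> passing near any given point of any \<open>G t\<close>.
  By Lindelof the support function is then the supremum of countably many functions
  \<open>w \<mapsto> \<phi> j t \<bullet> w\<close>.  A maximum of finitely many functions \<open>\<phi> j t \<bullet> p t\<close> is approximated in \<open>L\<^sup>1\<close> by a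
  single admissible function, by gluing the \<open>\<phi> j\<close> with continuous weights (inner regularity and
  Urysohn), and monotone convergence concludes.
\<close>

section \<open>Fenchel--Moreau duality for the perspective function\<close>

locale convex_integrand =
  fixes V :: "'a::euclidean_space set" and f :: "'a \<Rightarrow> 'm::euclidean_space \<Rightarrow> ennreal"
  assumes loc_compact: "locally_compact_space (top_of_set V)"
    and lsc: "lower_semicontinuous_on (V \<times> UNIV) (\<lambda>(t, x). f t x)"
    and convex: "\<And>t. t \<in> V \<Longrightarrow> convex_ennreal (f t)"
    and bounded_at_0: "locally_bounded_on V (\<lambda>t. f t 0)"
begin

text \<open>A pair \<open>(a, b)\<close> stands for the affine function sending \<open>p\<close> to
  \<open>a \<bullet> p + b\<close>. Negative values are truncated to \<open>0\<close> by
  \<open>ennreal\<close>; as \<open>f\<close> is nonnegative, the condition still says that this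
  function lies below \<open>f t\<close>.\<close>

definition minorants :: "'a \<Rightarrow> ('m \<times> real) set" where
  "minorants t = {z. \<forall>p. ennreal (z \<bullet> (p, 1)) \<le> f t p}"

text \<open>The support function of \<open>minorants t\<close>. Since \<open>0\<close> is a
  minorant, truncating negative values leaves the supremum unchanged.\<close>

definition support :: "'a \<Rightarrow> 'm \<times> real \<Rightarrow> ennreal" where
  "support t w = (SUP z\<in>minorants t. ennreal (z \<bullet> w))"

lemma minorantsD: "z \<in> minorants t \<Longrightarrow> ennreal (z \<bullet> (p, 1)) \<le> f t p"
  by (simp add: minorants_def)

text \<open>These constants lie below every nonnegative function. They make \<open>support\<close>
  infinite where the last coordinate is negative, and they force a nonnegative last coordinate on
  every direction in which the minorants are bounded above.\<close>

lemma nonpos_in_minorants: "b \<le> 0 \<Longrightarrow> (0, b) \<in> minorants t"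
  by (simp add: minorants_def ennreal_neg)

lemma zero_in_minorants: "0 \<in> minorants t"
  using nonpos_in_minorants[of 0] by (simp add: zero_prod_def)

lemma inner_le_support: "z \<in> minorants t \<Longrightarrow> ennreal (z \<bullet> w) \<le> support t w"
  unfolding support_def by (rule SUP_upper)

lemma bound_at_0:
  assumes "t \<in> V"
  obtains U C where "open U" "t \<in> U" "C \<ge> 0" "\<And>s. s \<in> V \<inter> U \<Longrightarrow> f s 0 \<le> ennreal C"
proof -
  obtain U C where "open U" "t \<in> U" "\<forall>s \<in> V \<inter> U. f s 0 \<le> ennreal C"
    using bounded_at_0 assms unfolding locally_bounded_on_def by blast
  moreover have "ennreal C \<le> ennreal (max C 0)"
    by (intro ennreal_leI) simp
  ultimately show ?thesis
    by (intro that[of U "max C 0"]) (auto intro: order_trans)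
qed

lemma convex_minorants: "convex (minorants t)"
proof (rule convexI)
  fix x y :: "'m \<times> real" and u v :: real
  assume xy: "x \<in> minorants t" "y \<in> minorants t" and uv: "0 \<le> u" "0 \<le> v" "u + v = 1"
  show "u *\<^sub>R x + v *\<^sub>R y \<in> minorants t"
    unfolding minorants_def
  proof safe
    fix p
    \<comment> \<open>Truncation by \<open>ennreal\<close> is not linear, so the combination is
      compared with the larger of the two values, which lies below \<open>f t p\<close> after
      truncation.\<close>
    let ?m = "max (x \<bullet> (p, 1)) (y \<bullet> (p, 1))"
    have "u * (x \<bullet> (p, 1)) + v * (y \<bullet> (p, 1)) \<le> u * ?m + v * ?m"
      using uv by (intro add_mono mult_left_mono) auto
    then have "(u *\<^sub>R x + v *\<^sub>R y) \<bullet> (p, 1) \<le> ?m"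
      using uv by (simp add: inner_add_left distrib_right[symmetric])
    then have "ennreal ((u *\<^sub>R x + v *\<^sub>R y) \<bullet> (p, 1)) \<le> ennreal ?m"
      by (rule ennreal_leI)
    also have "\<dots> \<le> f t p"
      using minorantsD[OF xy(1), of p] minorantsD[OF xy(2), of p] by (auto simp: max_def)
    finally show "ennreal ((u *\<^sub>R x + v *\<^sub>R y) \<bullet> (p, 1)) \<le> f t p" .
  qed
qed

lemma closed_minorants: "closed (minorants t)"
proof -
  have "minorants t = (\<Inter>p. {z. ennreal (z \<bullet> (p, 1)) \<le> f t p})"
    by (auto simp: minorants_def)
  moreover have "closed {z::'m \<times> real. ennreal (z \<bullet> (p, 1)) \<le> f t p}" for p
    by (intro closed_Collect_le continuous_intros continuous_on_ennreal)
  ultimately show ?thesis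
    by (metis (no_types, lifting) closed_INT)
qed

text \<open>Closedness of the epigraph when the base point moves as well. In this form lower
  semicontinuity enters both the separation argument and the inner semicontinuity of the
  minorants.\<close>

lemma lsc_seq:
  assumes "\<And>k. s k \<in> V" "t \<in> V" "s \<longlonglongrightarrow> t" "q \<longlonglongrightarrow> p" "r \<longlonglongrightarrow> l"
    and "\<And>k. f (s k) (q k) \<le> ennreal (r k)"
  shows "f t p \<le> ennreal l"
proof (rule ccontr)
  assume "\<not> f t p \<le> ennreal l"
  then obtain c where c: "ennreal l < c" "c < f t p"
    using dense not_le by metis
  have "eventually (\<lambda>y. c < (\<lambda>(t, x). f t x) y) (at (t, p) within V \<times> UNIV)"
    using lsc c(2) \<open>t \<in> V\<close> unfolding lower_semicontinuous_on_def by fastforce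
  then obtain W where W: "open W" "(t, p) \<in> W"
      "\<And>y. y \<in> W \<Longrightarrow> y \<noteq> (t, p) \<Longrightarrow> y \<in> V \<times> UNIV \<Longrightarrow> c < (\<lambda>(t, x). f t x) y"
    unfolding eventually_at_topological by blast
  have "(\<lambda>k. (s k, q k)) \<longlonglongrightarrow> (t, p)"
    by (intro tendsto_Pair assms)
  then have ev1: "eventually (\<lambda>k. (s k, q k) \<in> W) sequentially"
    using W topological_tendstoD by blast
  have "(\<lambda>k. ennreal (r k)) \<longlonglongrightarrow> ennreal l"
    by (intro tendsto_ennrealI assms)
  then have "eventually (\<lambda>k. ennreal (r k) < c) sequentially"
    using c(1) by (rule order_tendstoD(2))
  with ev1 have "eventually (\<lambda>k. False) sequentially"
  proof eventually_elim
    case (elim k)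
    \<comment> \<open>The filter \<open>at (t, p) within V \<times> UNIV\<close> omits the point
      itself, so the case of equality is settled by the choice of \<open>c\<close>.\<close>
    have "c < f (s k) (q k)"
      using W(3)[of "(s k, q k)"] elim assms(1) c(2) by (cases "(s k, q k) = (t, p)") auto
    then show ?case
      using elim assms(6)[of k] by (meson leD less_trans)
  qed
  then show False by simp
qed

text \<open>A vertical separating hyperplane is handled by adding large multiples of it to
  the minorant \<open>0\<close>.\<close>

lemma minorant_exists:
  assumes t: "t \<in> V" and r: "r \<ge> 0" "ennreal r < f t p"
  shows "\<exists>z\<in>minorants t. r < z \<bullet> (p, 1)"
proof -
  \<comment> \<open>The epigraph of \<open>f t\<close>. The clause \<open>0 \<le> s\<close> matters:
    \<open>ennreal\<close> maps negative \<open>s\<close> to \<open>0\<close>, which would put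
    points below the graph into the set wherever \<open>f t\<close> vanishes.\<close>
  define E where "E = {(q, s). 0 \<le> s \<and> f t q \<le> ennreal s}"
  have "convex E"
  proof (rule convexI)
    fix x y :: "'m \<times> real" and u v :: real
    assume xy: "x \<in> E" "y \<in> E" and uv: "0 \<le> u" "0 \<le> v" "u + v = 1"
    obtain q s q' s' where [simp]: "x = (q, s)" "y = (q', s')" by fastforce
    have le: "0 \<le> s" "f t q \<le> ennreal s" "0 \<le> s'" "f t q' \<le> ennreal s'"
      using xy by (auto simp: E_def)
    have "f t (u *\<^sub>R q + v *\<^sub>R q') \<le> ennreal u * f t q + ennreal v * f t q'"
      using convex[OF t] uv unfolding convex_ennreal_def by blast
    also have "\<dots> \<le> ennreal u * ennreal s + ennreal v * ennreal s'"
      using le by (intro add_mono mult_left_mono) auto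
    also have "\<dots> = ennreal (u * s + v * s')"
      using le uv by (simp add: ennreal_mult ennreal_plus)
    finally show "u *\<^sub>R x + v *\<^sub>R y \<in> E"
      using le uv by (simp add: E_def)
  qed
  moreover have "closed E"
    unfolding closed_sequential_limits
  proof safe
    fix x and q :: 'm and s :: real
    assume x: "\<forall>n. x n \<in> E" "x \<longlonglongrightarrow> (q, s)"
    have fst: "(\<lambda>n. fst (x n)) \<longlonglongrightarrow> q" and snd: "(\<lambda>n. snd (x n)) \<longlonglongrightarrow> s"
      using tendsto_fst[OF x(2)] tendsto_snd[OF x(2)] by auto
    have *: "0 \<le> snd (x n)" "f t (fst (x n)) \<le> ennreal (snd (x n))" for n
      using x(1)[rule_format, of n] by (auto simp: E_def)
    have "0 \<le> s"
      using snd by (rule LIMSEQ_le_const) (use *(1) in auto)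
    moreover have "f t q \<le> ennreal s"
      by (rule lsc_seq[OF t t tendsto_const fst snd *(2)])
    ultimately show "(q, s) \<in> E"
      by (simp add: E_def)
  qed
  moreover have "(p, r) \<notin> E"
    using r by (auto simp: E_def)
  ultimately obtain ab c where ab: "ab \<bullet> (p, r) < c" "\<And>x. x \<in> E \<Longrightarrow> ab \<bullet> x > c"
    using separating_hyperplane_closed_point by metis
  obtain a b where [simp]: "ab = (a, b)" by fastforce
  obtain C where C: "C \<ge> 0" "f t 0 \<le> ennreal C"
    using bound_at_0[OF t] t by (metis IntI)
  have sep: "a \<bullet> q + b * s > c" if "0 \<le> s" "f t q \<le> ennreal s" for q s
    using ab(2)[of "(q, s)"] that by (simp add: E_def)
  have p: "a \<bullet> p + b * r < c"
    using ab(1) by simp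
  have "b \<ge> 0"
  proof (rule ccontr)
    assume "\<not> b \<ge> 0"
    \<comment> \<open>Over \<open>0\<close> the epigraph contains every height from \<open>C\<close>
      upwards. If \<open>b\<close> were negative, a height of at least \<open>c / b\<close> would
      violate the strict separation.\<close>
    define s where "s = max C (c / b)"
    have "f t 0 \<le> ennreal s"
      using C(2) by (rule order_trans) (simp add: s_def ennreal_leI)
    then have "b * s > c"
      using sep[of s 0] C(1) by (auto simp: s_def)
    moreover have "b * s \<le> b * (c / b)"
      using \<open>\<not> b \<ge> 0\<close> by (intro mult_left_mono_neg) (auto simp: s_def)
    ultimately show False
      using \<open>\<not> b \<ge> 0\<close> by simp
  qed
  show ?thesis
  proof (cases "b = 0")
    case False
    with \<open>b \<ge> 0\<close> have "b > 0" by simp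
    \<comment> \<open>A nonvertical hyperplane is the graph of an affine function; solving its
      equation for the height gives the minorant.\<close>
    let ?z = "(- a /\<^sub>R b, c / b)"
    have "ennreal (?z \<bullet> (q, 1)) \<le> f t q" for q
    proof (cases "f t q")
      case (real s)
      then have "a \<bullet> q + b * s > c"
        using sep by simp
      then have "?z \<bullet> (q, 1) \<le> s"
        using \<open>b > 0\<close> by (simp add: field_simps)
      then show ?thesis
        using real by (simp add: ennreal_leI)
    qed simp
    then have "?z \<in> minorants t"
      by (simp add: minorants_def)
    moreover have "r < ?z \<bullet> (p, 1)"
      using p \<open>b > 0\<close> by (simp add: field_simps)
    ultimately show ?thesis by blast
  next
    case True
    \<comment> \<open>The multiple is chosen so that \<open>n * (c - a \<bullet> p)\<close> equals
      \<open>r + 1\<close>, while \<open>n * (c - a \<bullet> q)\<close> is nonpositive wherever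
      \<open>f t q\<close> is finite.\<close>
    define n where "n = (r + 1) / (c - a \<bullet> p)"
    have cp: "c - a \<bullet> p > 0"
      using p True by simp
    then have n: "n \<ge> 0" "n * (c - a \<bullet> p) = r + 1"
      using r by (auto simp: n_def)
    let ?z = "(- n *\<^sub>R a, n * c)"
    have "ennreal (?z \<bullet> (q, 1)) \<le> f t q" for q
    proof (cases "f t q")
      case (real s)
      then have "a \<bullet> q > c"
        using sep[of s q] True by simp
      then have "n * c \<le> n * (a \<bullet> q)"
        using n by (intro mult_left_mono) auto
      then show ?thesis
        by (simp add: ennreal_neg)
    qed simp
    then have "?z \<in> minorants t"
      by (simp add: minorants_def)
    moreover have "r < ?z \<bullet> (p, 1)"
      using n(2) by (simp add: algebra_simps)
    ultimately show ?thesis by blast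
  qed
qed

text \<open>Fenchel--Moreau duality at height 1. Passing to finite levels below \<open>f t p\<close>
  by \<open>dense_le\<close> treats infinite values at the same time.\<close>

lemma support_1:
  assumes t: "t \<in> V"
  shows "support t (p, 1) = f t p"
proof (rule antisym)
  show "support t (p, 1) \<le> f t p"
    unfolding support_def by (rule SUP_least) (rule minorantsD)
  show "f t p \<le> support t (p, 1)"
  proof (rule dense_le)
    fix x assume x: "x < f t p"
    then obtain r where r: "x = ennreal r" "r \<ge> 0"
      by (cases x) auto
    then obtain z where "z \<in> minorants t" "r < z \<bullet> (p, 1)"
      using minorant_exists[OF t, of r p] x by auto
    then show "x \<le> support t (p, 1)"
      using inner_le_support[of z t "(p, 1)"] r
      by (meson ennreal_leI less_imp_le order_trans)
  qed
qed

lemma support_scaleR: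
  assumes "c > 0"
  shows "support t (c *\<^sub>R w) = ennreal c * support t w"
  unfolding support_def SUP_mult_left_ennreal
  using assms by (intro SUP_cong refl) (simp add: ennreal_mult')

lemma support_add: "support t (w + w') \<le> support t w + support t w'"
  unfolding support_def[of t "w + w'"]
proof (rule SUP_least)
  fix z assume z: "z \<in> minorants t"
  have "ennreal (z \<bullet> (w + w')) \<le> ennreal (z \<bullet> w) + ennreal (z \<bullet> w')"
    by (cases "z \<bullet> w \<ge> 0"; cases "z \<bullet> w' \<ge> 0")
      (auto simp: inner_add_right ennreal_plus[symmetric] ennreal_neg intro!: ennreal_leI simp del: ennreal_plus)
  also have "\<dots> \<le> support t w + support t w'"
    using z by (intro add_mono inner_le_support)
  finally show "ennreal (z \<bullet> (w + w')) \<le> support t w + support t w'" .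
qed

lemma support_pos:
  assumes "t \<in> V" "l > 0"
  shows "support t (x, l) = ennreal l * f t (x /\<^sub>R l)"
  using support_scaleR[of l t "(x /\<^sub>R l, 1)"] support_1[of t "x /\<^sub>R l"] assms by simp

lemma support_neg:
  assumes "l < 0"
  shows "support t (x, l) = \<infinity>"
proof -
  have "r \<le> support t (x, l)" if fin: "r < top" for r
  proof -
    obtain r' where r: "r = ennreal r'" "r' \<ge> 0"
      using fin by (cases r) auto
    \<comment> \<open>For negative \<open>l\<close> this constant is nonpositive, and it pairs with
      \<open>(x, l)\<close> to exactly \<open>r'\<close>.\<close>
    have "(0, r' / l) \<in> minorants t"
      using r assms by (intro nonpos_in_minorants) (auto simp: field_simps)
    from inner_le_support[OF this, of "(x, l)"] show ?thesis
      using r assms by simp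
  qed
  then have "top \<le> support t (x, l)" by (rule dense_le)
  then show ?thesis by (simp add: top.extremum_unique)
qed

text \<open>The lower bound holds because \<open>support\<close> is a supremum of continuous
  functions. The upper bound comes from subadditivity: moving from \<open>(x, 0)\<close> to
  \<open>(x, \<rho>)\<close> costs at most \<open>\<rho> * f t 0\<close>, and \<open>f t 0\<close>
  is finite.\<close>

lemma tendsto_support_0:
  assumes t: "t \<in> V"
  shows "((\<lambda>\<rho>. support t (x, \<rho>)) \<longlongrightarrow> support t (x, 0)) (at_right 0)"
proof (rule order_tendstoI)
  fix c assume "c < support t (x, 0)"
  then obtain z where z: "z \<in> minorants t" "c < ennreal (z \<bullet> (x, 0))"
    unfolding support_def less_SUP_iff by blast
  have "((\<lambda>\<rho>. ennreal (z \<bullet> (x, \<rho>))) \<longlongrightarrow> ennreal (z \<bullet> (x, 0))) (at_right 0)"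
    by (intro tendsto_ennrealI tendsto_intros)
  then have "eventually (\<lambda>\<rho>. c < ennreal (z \<bullet> (x, \<rho>))) (at_right 0)"
    using z(2) by (rule order_tendstoD)
  then show "eventually (\<lambda>\<rho>. c < support t (x, \<rho>)) (at_right 0)"
    by eventually_elim (meson inner_le_support less_le_trans z(1))
next
  fix c assume c: "support t (x, 0) < c"
  obtain C where C: "C \<ge> 0" "f t 0 \<le> ennreal C"
    using bound_at_0[OF t] t by (metis IntI)
  have le: "support t (x, \<rho>) \<le> support t (x, 0) + ennreal (\<rho> * C)" if "\<rho> > 0" for \<rho>
  proof -
    have "support t (x, \<rho>) \<le> support t (x, 0) + support t (0, \<rho>)"
      using support_add[of t "(x, 0)" "(0, \<rho>)"] by simp
    also have "support t (0, \<rho>) = ennreal \<rho> * f t 0"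
      using support_pos[OF t that, of 0] by simp
    also have "\<dots> \<le> ennreal \<rho> * ennreal C"
      using C by (intro mult_left_mono) auto
    finally show ?thesis
      using C that by (simp add: ennreal_mult)
  qed
  have "((\<lambda>\<rho>. support t (x, 0) + ennreal (\<rho> * C)) \<longlongrightarrow> support t (x, 0) + ennreal (0 * C)) (at_right 0)"
    by (intro tendsto_add tendsto_ennrealI tendsto_intros)
  then have "eventually (\<lambda>\<rho>. support t (x, 0) + ennreal (\<rho> * C) < c) (at_right 0)"
    using c by (intro order_tendstoD) auto
  moreover have "eventually (\<lambda>\<rho>::real. \<rho> > 0) (at_right 0)"
    by (rule eventually_at_right_less)
  ultimately show "eventually (\<lambda>\<rho>. support t (x, \<rho>) < c) (at_right 0)"
    by eventually_elim (meson le le_less_trans)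
qed

text \<open>At height 0 the limit in the definition of \<open>perspective\<close> exists by
  \<open>tendsto_support_0\<close>, so that \<open>Lim\<close> returns its actual value.\<close>

lemma perspective_eq_support:
  assumes t: "t \<in> V"
  shows "perspective f t x l = support t (x, l)"
proof -
  consider "l > 0" | "l < 0" | "l = 0" by linarith
  then show ?thesis
  proof cases
    case 3
    have "eventually (\<lambda>\<rho>::real. support t (x, \<rho>) = ennreal \<rho> * f t (x /\<^sub>R \<rho>)) (at_right 0)"
      using eventually_at_right_less[of 0] by eventually_elim (simp add: support_pos[OF t])
    then have "((\<lambda>\<rho>. ennreal \<rho> * f t (x /\<^sub>R \<rho>)) \<longlongrightarrow> support t (x, 0)) (at_right 0)"
      by (rule Lim_transform_eventually[OF tendsto_support_0[OF t]])
    then show ?thesis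
      using 3 by (simp add: perspective_def tendsto_Lim)
  qed (use t in \<open>auto simp: perspective_def support_pos support_neg\<close>)
qed

section \<open>Inner semicontinuity of the set of affine minorants\<close>

text \<open>The direction \<open>w\<close> points from the projection \<open>y\<close> of
  \<open>z0\<close> onto the closed convex set \<open>minorants t\<close> towards \<open>z0\<close>.
  The obtuse angle property of the projection gives the bound.\<close>

lemma supporting_direction:
  assumes "\<epsilon> > 0" and far: "\<And>z. z \<in> minorants t \<Longrightarrow> \<epsilon> \<le> dist z z0"
  shows "\<exists>w. norm w = 1 \<and> (\<forall>z\<in>minorants t. z \<bullet> w \<le> z0 \<bullet> w - \<epsilon>)"
proof -
  define y where "y = closest_point (minorants t) z0"
  have y: "y \<in> minorants t"
    unfolding y_def using closed_minorants zero_in_minorants by (intro closest_point_in_set) auto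
  define w where "w = (z0 - y) /\<^sub>R norm (z0 - y)"
  have d: "norm (z0 - y) \<ge> \<epsilon>"
    using far[OF y] by (simp add: dist_norm norm_minus_commute)
  then have nz: "norm (z0 - y) > 0"
    using \<open>\<epsilon> > 0\<close> by linarith
  have "z \<bullet> w \<le> z0 \<bullet> w - \<epsilon>" if z: "z \<in> minorants t" for z
  proof -
    have "(z0 - y) \<bullet> (z - y) \<le> 0"
      unfolding y_def by (rule closest_point_dot[OF convex_minorants closed_minorants z])
    then have "(z - y) \<bullet> w \<le> 0"
      using nz by (simp add: w_def inner_commute divide_simps)
    moreover have "(z0 - y) \<bullet> w = norm (z0 - y)"
      using nz by (simp add: w_def dot_square_norm power2_eq_square)
    ultimately show ?thesis
      using d by (simp add: inner_diff_left)
  qed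
  moreover have "norm w = 1"
    using nz by (simp add: w_def)
  ultimately show ?thesis by blast
qed

text \<open>If this fails, there are unit directions \<open>w k\<close>, converging to some \<open>w\<close>, in which the support functions
  at points \<open>s k\<close> tending to \<open>t\<close> stay below \<open>z0 \<bullet> w k - \<epsilon>\<close>.  Tilting \<open>w k\<close> slightly by
  \<open>(0, \<delta>)\<close> makes the last coordinate positive, so that lower semicontinuity of \<open>f\<close> applies;
  the local bound on \<open>f s 0\<close> controls the error.\<close>

lemma minorants_inner_semicontinuous:
  assumes t: "t \<in> V" and z0: "z0 \<in> minorants t" and \<epsilon>: "\<epsilon> > 0"
  shows "\<exists>\<delta>>0. \<forall>s\<in>V. dist s t < \<delta> \<longrightarrow> (\<exists>z\<in>minorants s. dist z z0 < \<epsilon>)"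
proof (rule ccontr)
  assume not: "\<not> ?thesis"
  obtain U C where U: "open U" "t \<in> U" "C \<ge> 0" "\<And>s. s \<in> V \<inter> U \<Longrightarrow> f s 0 \<le> ennreal C"
    using bound_at_0[OF t] by blast
  obtain d where d: "d > 0" "ball t d \<subseteq> U"
    using U open_contains_ball by blast
  \<comment> \<open>Staying within \<open>d\<close> keeps \<open>s k\<close> in the region where
    \<open>f s 0\<close> is bounded by \<open>C\<close>; the second bound makes \<open>s\<close>
    converge to \<open>t\<close>.\<close>
  have "\<exists>s. s \<in> V \<and> dist s t < min d (1 / Suc k) \<and> (\<forall>z\<in>minorants s. \<epsilon> \<le> dist z z0)" for k
  proof -
    have "min d (1 / Suc k) > 0" using d by simp
    then show ?thesis using not by (meson not_le)
  qed
  then obtain s where s: "\<And>k. s k \<in> V" "\<And>k. dist (s k) t < min d (1 / Suc k)"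
      "\<And>k z. z \<in> minorants (s k) \<Longrightarrow> \<epsilon> \<le> dist z z0"
    by metis
  have "\<exists>w. norm w = 1 \<and> (\<forall>z\<in>minorants (s k). z \<bullet> w \<le> z0 \<bullet> w - \<epsilon>)" for k
    by (rule supporting_direction[OF \<epsilon> s(3)])
  then obtain w where w: "\<And>k. norm (w k) = 1"
      "\<And>k z. z \<in> minorants (s k) \<Longrightarrow> z \<bullet> w k \<le> z0 \<bullet> w k - \<epsilon>"
    by metis
  have "compact (sphere (0::'m \<times> real) 1)" "\<forall>k. w k \<in> sphere 0 1"
    using w by auto
  then obtain w0 \<sigma> where w0: "strict_mono \<sigma>" "(w \<circ> \<sigma>) \<longlonglongrightarrow> w0"
    unfolding compact_def by metis
  have snd_w: "snd (w k) \<ge> 0" for k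
  proof (rule ccontr)
    assume "\<not> snd (w k) \<ge> 0"
    \<comment> \<open>With a negative last coordinate of \<open>w k\<close>, this constant minorant
      would reach the value \<open>\<bar>z0 \<bullet> w k\<bar> + 1\<close>, above the bound for all
      minorants.\<close>
    moreover define b where "b = (\<bar>z0 \<bullet> w k\<bar> + 1) / snd (w k)"
    ultimately have "b * snd (w k) = \<bar>z0 \<bullet> w k\<bar> + 1" "b \<le> 0"
      by (auto simp: divide_nonneg_neg)
    moreover have "(0, b) \<bullet> w k = b * snd (w k)"
      by (cases "w k") simp
    ultimately show False
      using w(2)[OF nonpos_in_minorants, of b k] \<epsilon> by simp
  qed
  have pos: "0 \<le> z0 \<bullet> w k - \<epsilon>" for k
    using w(2)[OF zero_in_minorants, of k] by simp
  have s_lim: "s \<longlonglongrightarrow> t"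
  proof (rule metric_LIMSEQ_I)
    fix r :: real assume "r > 0"
    then obtain N where "1 / Suc N < r"
      using nat_approx_posE by blast
    then have "dist (s k) t < r" if "k \<ge> N" for k
      using s(2)[of k] that frac_le[of 1 1 "real (Suc N)" "real (Suc k)"] by simp
    then show "\<exists>N. \<forall>n\<ge>N. dist (s n) t < r" by blast
  qed
  \<comment> \<open>The last coordinate of a minorant is its value at \<open>0\<close>, hence
    limited by the local bound on \<open>f r 0\<close>.\<close>
  have C_bound: "snd z \<le> C" if "z \<in> minorants r" "r \<in> V \<inter> U" for z r
  proof -
    have "ennreal (snd z) \<le> ennreal C"
      using minorantsD[OF that(1), of 0] U(4)[OF that(2)]
      by (cases z) (auto intro: order_trans)
    then show ?thesis
      using U(3) by (cases "snd z \<ge> 0") auto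
  qed
  have sU: "s k \<in> V \<inter> U" for k
    using s(1,2)[of k] d(2) by (auto simp: dist_commute)
  \<comment> \<open>The tilt causes a total error of \<open>\<delta> * (C - snd z0)\<close>. This
    choice keeps it below \<open>\<epsilon>\<close>, and the summand 1 keeps the denominator
    positive when \<open>C = snd z0\<close>.\<close>
  define \<delta> where "\<delta> = \<epsilon> / (2 * (C - snd z0 + 1))"
  have z0C: "snd z0 \<le> C"
    using C_bound[OF z0] t U by blast
  have \<delta>: "\<delta> > 0" "\<delta> * (C - snd z0) < \<epsilon>"
  proof -
    show "\<delta> > 0"
      using \<epsilon> z0C by (simp add: \<delta>_def)
    have "\<epsilon> = \<delta> * (2 * (C - snd z0 + 1))"
      using z0C by (simp add: \<delta>_def)
    also have "\<dots> = 2 * (\<delta> * (C - snd z0)) + 2 * \<delta>"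
      by (simp add: algebra_simps)
    finally have "\<epsilon> = 2 * (\<delta> * (C - snd z0)) + 2 * \<delta>" .
    moreover have "\<delta> * (C - snd z0) \<ge> 0"
      using z0C \<open>\<delta> > 0\<close> by simp
    ultimately show "\<delta> * (C - snd z0) < \<epsilon>"
      using \<open>\<delta> > 0\<close> by linarith
  qed
  \<comment> \<open>The tilted direction \<open>w k + (0, \<delta>)\<close>, divided by its positive
    last coordinate, is \<open>(q k, 1)\<close>; \<open>r k\<close> bounds all minorants at
    \<open>s k\<close> in that direction.\<close>
  define q where "q k = fst (w k) /\<^sub>R (snd (w k) + \<delta>)" for k
  define r where "r k = (z0 \<bullet> w k - \<epsilon> + \<delta> * C) / (snd (w k) + \<delta>)" for k
  have le: "f (s k) (q k) \<le> ennreal (r k)" for k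
  proof -
    let ?l = "snd (w k) + \<delta>"
    have l: "?l > 0" using snd_w[of k] \<delta> by linarith
    have "ennreal (z \<bullet> (q k, 1)) \<le> ennreal (r k)" if z: "z \<in> minorants (s k)" for z
    proof -
      have "?l * (z \<bullet> (q k, 1)) = z \<bullet> w k + \<delta> * snd z"
        using l by (cases z; cases "w k") (simp add: q_def field_simps)
      also have "\<dots> \<le> z0 \<bullet> w k - \<epsilon> + \<delta> * C"
        using w(2)[OF z] C_bound[OF z sU] \<delta>(1) by (intro add_mono mult_left_mono) auto
      finally have "z \<bullet> (q k, 1) \<le> r k"
        using l by (simp add: r_def field_simps)
      then show ?thesis by (rule ennreal_leI)
    qed
    then have "support (s k) (q k, 1) \<le> ennreal (r k)"
      unfolding support_def by (rule SUP_least)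
    then show ?thesis
      by (simp add: support_1[OF s(1)])
  qed
  have lim_w: "(\<lambda>k. w (\<sigma> k)) \<longlonglongrightarrow> w0"
    using w0(2) by (simp add: o_def)
  have lim_s: "(\<lambda>k. s (\<sigma> k)) \<longlonglongrightarrow> t"
    using LIMSEQ_subseq_LIMSEQ[OF s_lim w0(1)] by (simp add: o_def)
  have lim_snd: "(\<lambda>k. snd (w (\<sigma> k))) \<longlonglongrightarrow> snd w0"
    by (intro tendsto_intros lim_w)
  have snd_w0: "snd w0 \<ge> 0"
    using lim_snd by (rule LIMSEQ_le_const) (use snd_w in auto)
  define q0 where "q0 = fst w0 /\<^sub>R (snd w0 + \<delta>)"
  define r0 where "r0 = (z0 \<bullet> w0 - \<epsilon> + \<delta> * C) / (snd w0 + \<delta>)"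
  have "f t q0 \<le> ennreal r0"
  proof (rule lsc_seq[of "\<lambda>k. s (\<sigma> k)" t "\<lambda>k. q (\<sigma> k)" _ "\<lambda>k. r (\<sigma> k)"])
    show "(\<lambda>k. q (\<sigma> k)) \<longlonglongrightarrow> q0" "(\<lambda>k. r (\<sigma> k)) \<longlonglongrightarrow> r0"
      unfolding q_def r_def q0_def r0_def using snd_w0 \<delta>
      by (auto intro!: tendsto_intros lim_w)
  qed (use s t lim_s le in auto)
  then have le0: "ennreal (z0 \<bullet> (q0, 1)) \<le> ennreal r0"
    using minorantsD[OF z0, of q0] by (rule order_trans[rotated])
  \<comment> \<open>It makes \<open>r0\<close> nonnegative, so that the inequality between truncated
    values in \<open>le0\<close> can be read as one between reals.\<close>
  have "0 \<le> z0 \<bullet> w0 - \<epsilon>"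
  proof (rule LIMSEQ_le_const)
    show "(\<lambda>k. z0 \<bullet> w (\<sigma> k) - \<epsilon>) \<longlonglongrightarrow> z0 \<bullet> w0 - \<epsilon>"
      by (intro tendsto_intros lim_w)
  qed (use pos in auto)
  then have "r0 \<ge> 0"
    using U(3) \<delta>(1) snd_w0 by (simp add: r0_def)
  with le0 have "z0 \<bullet> (q0, 1) \<le> r0"
    by (cases "z0 \<bullet> (q0, 1) \<ge> 0") auto
  moreover have l0: "snd w0 + \<delta> > 0"
    using snd_w0 \<delta> by linarith
  \<comment> \<open>Clearing the denominator leaves \<open>z0 \<bullet> w0\<close> on both sides;
    what remains contradicts the choice of \<open>\<delta>\<close>.\<close>
  ultimately have "(snd w0 + \<delta>) * (z0 \<bullet> (q0, 1)) \<le> (snd w0 + \<delta>) * r0"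
    by (intro mult_left_mono) auto
  moreover have "(snd w0 + \<delta>) * (z0 \<bullet> (q0, 1)) = z0 \<bullet> w0 + \<delta> * snd z0"
    using l0 by (cases z0; cases w0) (simp add: q0_def field_simps)
  moreover have "(snd w0 + \<delta>) * r0 = z0 \<bullet> w0 - \<epsilon> + \<delta> * C"
    using l0 by (simp add: r0_def)
  ultimately have "\<epsilon> \<le> \<delta> * (C - snd z0)"
    by (simp add: algebra_simps)
  with \<delta>(2) show False by simp
qed

end

section \<open>Continuous selections\<close>

text \<open>Lower hemicontinuity of a set-valued map, the notion in Michael's selection theorem, in
  metric form.\<close>

definition inner_semicontinuous_on ::
    "'a::metric_space set \<Rightarrow> ('a \<Rightarrow> 'b::metric_space set) \<Rightarrow> bool" where
  "inner_semicontinuous_on K G \<longleftrightarrow>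
     (\<forall>t\<in>K. \<forall>z\<in>G t. \<forall>\<epsilon>>0. \<exists>\<delta>>0. \<forall>s\<in>K. dist s t < \<delta> \<longrightarrow> (\<exists>y\<in>G s. dist y z < \<epsilon>))"

text \<open>A partition of unity on a finite cover averages the points \<open>z t\<close>. At
  \<open>x\<close> only those \<open>z t\<close> count that are \<open>\<epsilon>\<close>-close to
  \<open>G x\<close>, and the \<open>\<epsilon>\<close>-neighbourhood of a convex set is
  convex.\<close>

lemma approximate_selection:
  fixes G :: "'a::metric_space \<Rightarrow> 'b::real_normed_vector set"
  assumes K: "compact K" and G: "inner_semicontinuous_on K G"
    and conv: "\<And>t. t \<in> K \<Longrightarrow> convex (G t)" and ne: "\<And>t. t \<in> K \<Longrightarrow> G t \<noteq> {}"
    and \<epsilon>: "\<epsilon> > 0"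
  shows "\<exists>\<psi>. continuous_on K \<psi> \<and> (\<forall>t\<in>K. \<exists>z\<in>G t. dist (\<psi> t) z < \<epsilon>)"
proof -
  have "\<forall>t\<in>K. \<exists>z \<delta>. \<delta> > 0 \<and> (\<forall>s\<in>K. dist s t < \<delta> \<longrightarrow> (\<exists>y\<in>G s. dist y z < \<epsilon>))"
    using G ne \<epsilon> unfolding inner_semicontinuous_on_def by (metis ex_in_conv)
  then obtain z \<delta> where z: "\<And>t. t \<in> K \<Longrightarrow> \<delta> t > 0"
      "\<And>t s. t \<in> K \<Longrightarrow> s \<in> K \<Longrightarrow> dist s t < \<delta> t \<Longrightarrow> \<exists>y\<in>G s. dist y (z t) < \<epsilon>"
    by metis
  have "K \<subseteq> (\<Union>t\<in>K. ball t (\<delta> t))"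
    using z(1) by fastforce
  then obtain D where D: "D \<subseteq> K" "finite D" "K \<subseteq> (\<Union>t\<in>D. ball t (\<delta> t))"
    using compactE_image[OF K, of K "\<lambda>t. ball t (\<delta> t)"] by auto
  define w where "w t x = max 0 (\<delta> t - dist x t)" for t x
  define W where "W x = (\<Sum>t\<in>D. w t x)" for x
  define \<psi> where "\<psi> x = (\<Sum>t\<in>D. (w t x / W x) *\<^sub>R z t)" for x
  have w_nonneg: "w t x \<ge> 0" for t x
    by (simp add: w_def)
  have W_pos: "W x > 0" if x: "x \<in> K" for x
  proof -
    obtain t where "t \<in> D" "x \<in> ball t (\<delta> t)"
      using D(3) x by blast
    then show ?thesis
      unfolding W_def using D(2) w_nonneg
      by (intro sum_pos2[of D t]) (auto simp: w_def dist_commute)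
  qed
  have "continuous_on K \<psi>"
    unfolding \<psi>_def W_def w_def
    by (intro continuous_intros) (use W_pos in \<open>force simp: W_def w_def\<close>)
  moreover have "\<exists>y\<in>G x. dist (\<psi> x) y < \<epsilon>" if x: "x \<in> K" for x
  proof -
    \<comment> \<open>Only a positive weight guarantees that \<open>z t\<close> is near
      \<open>G x\<close>, so the other indices are dropped. The neighbourhood \<open>?N\<close> is
      written as a Minkowski sum in order to use \<open>convex_sums\<close>.\<close>
    define D' where "D' = {t \<in> D. w t x > 0}"
    let ?N = "\<Union>g\<in>G x. \<Union>e\<in>ball 0 \<epsilon>. {g + e}"
    have "\<psi> x = (\<Sum>t\<in>D'. (w t x / W x) *\<^sub>R z t)"
      unfolding \<psi>_def D'_def using D(2) w_nonneg[of _ x]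
      by (intro sum.mono_neutral_right) (auto simp: order.order_iff_strict)
    also have "\<dots> \<in> ?N"
    proof (rule convex_sum)
      show "convex ?N"
        by (intro convex_sums conv x convex_ball)
      show "(\<Sum>t\<in>D'. w t x / W x) = 1"
      proof -
        have "W x = (\<Sum>t\<in>D'. w t x)"
          unfolding W_def D'_def using D(2) w_nonneg[of _ x]
          by (intro sum.mono_neutral_right) (auto simp: order.order_iff_strict)
        then show ?thesis
          using W_pos[OF x] by (simp add: sum_divide_distrib[symmetric])
      qed
      show "z t \<in> ?N" if "t \<in> D'" for t
      proof -
        have "t \<in> K" "dist x t < \<delta> t"
          using that D(1) by (auto simp: D'_def w_def)
        then obtain y where y: "y \<in> G x" "dist y (z t) < \<epsilon>"
          using z(2) x by blast
        then have "z t = y + (z t - y)" "z t - y \<in> ball 0 \<epsilon>"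
          by (auto simp: dist_norm norm_minus_commute)
        with y show ?thesis by blast
      qed
    qed (use D(2) W_pos[OF x] w_nonneg in \<open>auto simp: D'_def\<close>)
    finally obtain y e where "y \<in> G x" "e \<in> ball 0 \<epsilon>" "\<psi> x = y + e"
      by blast
    then show ?thesis
      by (intro bexI[of _ y]) (auto simp: dist_norm)
  qed
  ultimately show ?thesis by blast
qed

text \<open>This permits iteration: the next approximate selection is sought inside a ball around
  the previous one. Openness of the ball leaves room for both \<open>\<psi>\<close> and the chosen
  point to move.\<close>

lemma inner_semicontinuous_on_Int_ball:
  fixes \<psi> :: "'a::metric_space \<Rightarrow> 'b::metric_space"
  assumes G: "inner_semicontinuous_on K G" and \<psi>: "continuous_on K \<psi>"
  shows "inner_semicontinuous_on K (\<lambda>t. G t \<inter> ball (\<psi> t) r)"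
  unfolding inner_semicontinuous_on_def
proof safe
  fix t z and \<epsilon> :: real
  assume t: "t \<in> K" "z \<in> G t" "z \<in> ball (\<psi> t) r" and \<epsilon>: "\<epsilon> > 0"
  \<comment> \<open>Half of the slack of \<open>z\<close> in the ball: one half is spent on the
    variation of \<open>\<psi>\<close>, the other on moving from \<open>z\<close> to
    \<open>y\<close>.\<close>
  define \<eta> where "\<eta> = (r - dist (\<psi> t) z) / 2"
  have \<eta>: "\<eta> > 0" using t by (simp add: \<eta>_def)
  obtain d1 where d1: "d1 > 0"
      "\<And>s. s \<in> K \<Longrightarrow> dist s t < d1 \<Longrightarrow> \<exists>y\<in>G s. dist y z < min \<epsilon> \<eta>"
    using G t \<epsilon> \<eta> unfolding inner_semicontinuous_on_def by (metis min_less_iff_conj)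
  obtain d2 where d2: "d2 > 0" "\<And>s. s \<in> K \<Longrightarrow> dist s t < d2 \<Longrightarrow> dist (\<psi> s) (\<psi> t) < \<eta>"
    using \<psi> t(1) \<eta> unfolding continuous_on_iff by metis
  have "\<exists>y\<in>G s \<inter> ball (\<psi> s) r. dist y z < \<epsilon>" if s: "s \<in> K" "dist s t < min d1 d2" for s
  proof -
    obtain y where y: "y \<in> G s" "dist y z < \<epsilon>" "dist y z < \<eta>"
      using d1(2)[of s] s by auto
    have "dist (\<psi> s) y \<le> dist (\<psi> s) (\<psi> t) + dist (\<psi> t) z + dist y z"
      using dist_triangle[of "\<psi> s" y "\<psi> t"] dist_triangle[of "\<psi> t" y z]
      by (simp add: dist_commute)
    also have "\<dots> < \<eta> + dist (\<psi> t) z + \<eta>"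
      using d2(2)[of s] s y by simp
    also have "\<dots> = r"
      by (simp add: \<eta>_def field_simps)
    finally show ?thesis
      using y by auto
  qed
  then show "\<exists>\<delta>>0. \<forall>s\<in>K. dist s t < \<delta> \<longrightarrow> (\<exists>y\<in>G s \<inter> ball (\<psi> s) r. dist y z < \<epsilon>)"
    using d1 d2 by (intro exI[of _ "min d1 d2"]) auto
qed

text \<open>Michael's iteration started at the constant \<open>z0\<close>. The \<open>n\<close>-th
  function is within \<open>\<epsilon> / 2 ^ n\<close> of \<open>G\<close>, and the increments are
  at most \<open>2 * \<epsilon> / 2 ^ n\<close>, which sum to \<open>4 * \<epsilon>\<close>.\<close>

lemma selection_near_constant:
  fixes G :: "'a::metric_space \<Rightarrow> 'b::banach set"
  assumes K: "compact K" and G: "inner_semicontinuous_on K G"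
    and conv: "\<And>t. t \<in> K \<Longrightarrow> convex (G t)" and cl: "\<And>t. t \<in> K \<Longrightarrow> closed (G t)"
    and near: "\<And>t. t \<in> K \<Longrightarrow> \<exists>z\<in>G t. dist z0 z < \<epsilon>" and \<epsilon>: "\<epsilon> > 0"
  shows "\<exists>\<psi>. continuous_on K \<psi> \<and> (\<forall>t\<in>K. \<psi> t \<in> G t \<and> dist (\<psi> t) z0 \<le> 4 * \<epsilon>)"
proof -
  \<comment> \<open>The clause for \<open>n = 0\<close> fixes the starting function, so that
    \<open>z0\<close> plus the telescoping increments recovers the sequence.\<close>
  let ?P = "\<lambda>n \<psi>. (n = 0 \<longrightarrow> \<psi> = (\<lambda>_. z0)) \<and> continuous_on K \<psi> \<and>
      (\<forall>t\<in>K. \<exists>z\<in>G t. dist (\<psi> t) z < \<epsilon> / 2 ^ n)"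
  let ?Q = "\<lambda>n \<psi> \<psi>'. \<forall>t\<in>K. dist (\<psi>' t) (\<psi> t) \<le> 2 * \<epsilon> / 2 ^ n"
  have "\<exists>F. \<forall>n. ?P n (F n) \<and> ?Q n (F n) (F (Suc n))"
  proof (rule dependent_nat_choice)
    show "\<exists>\<psi>. ?P 0 \<psi>"
      using near by (intro exI[of _ "\<lambda>_. z0"]) auto
    fix \<psi> n assume P: "?P n \<psi>"
    \<comment> \<open>Selecting inside the ball around \<open>\<psi> t\<close> controls the
      increment: \<open>\<psi>' t\<close> and \<open>\<psi> t\<close> are both close to a common
      point of \<open>G t\<close>.\<close>
    have "\<exists>\<psi>'. continuous_on K \<psi>' \<and>
        (\<forall>t\<in>K. \<exists>z\<in>G t \<inter> ball (\<psi> t) (\<epsilon> / 2 ^ n). dist (\<psi>' t) z < \<epsilon> / 2 ^ Suc n)"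
    proof (rule approximate_selection[OF K])
      show "inner_semicontinuous_on K (\<lambda>t. G t \<inter> ball (\<psi> t) (\<epsilon> / 2 ^ n))"
        using G P by (intro inner_semicontinuous_on_Int_ball) auto
      show "convex (G t \<inter> ball (\<psi> t) (\<epsilon> / 2 ^ n))" if "t \<in> K" for t
        by (intro convex_Int conv that convex_ball)
      show "G t \<inter> ball (\<psi> t) (\<epsilon> / 2 ^ n) \<noteq> {}" if "t \<in> K" for t
        using P that by fastforce
    qed (use \<epsilon> in simp)
    then obtain \<psi>' where \<psi>': "continuous_on K \<psi>'"
        "\<And>t. t \<in> K \<Longrightarrow> \<exists>z\<in>G t \<inter> ball (\<psi> t) (\<epsilon> / 2 ^ n). dist (\<psi>' t) z < \<epsilon> / 2 ^ Suc n"
      by blast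
    have "dist (\<psi>' t) (\<psi> t) \<le> 2 * \<epsilon> / 2 ^ n" if t: "t \<in> K" for t
    proof -
      obtain z where z: "dist (\<psi> t) z < \<epsilon> / 2 ^ n" "dist (\<psi>' t) z < \<epsilon> / 2 ^ Suc n"
        using \<psi>'(2)[OF t] by auto
      have "dist (\<psi>' t) (\<psi> t) \<le> dist (\<psi>' t) z + dist (\<psi> t) z"
        by (metis dist_commute dist_triangle)
      also have "\<dots> \<le> \<epsilon> / 2 ^ n + \<epsilon> / 2 ^ n"
        using z \<epsilon> by (intro add_mono) (auto simp: field_simps)
      finally show ?thesis by (simp add: field_simps)
    qed
    then show "\<exists>\<psi>'. ?P (Suc n) \<psi>' \<and> ?Q n \<psi> \<psi>'"
      using \<psi>' by (intro exI[of _ \<psi>']) auto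
  qed
  then obtain F where F: "\<And>n. ?P n (F n)" "\<And>n. ?Q n (F n) (F (Suc n))"
    by blast
  have F0: "F 0 = (\<lambda>_. z0)"
    using F(1)[of 0] by simp
  have sums: "(\<lambda>n. 2 * \<epsilon> / 2 ^ n) sums (4 * \<epsilon>)"
    using sums_mult[OF geometric_sums[of "1/2 :: real"], of "2 * \<epsilon>"]
    by (simp add: power_one_over)
  have bound: "norm (F (Suc n) t - F n t) \<le> 2 * \<epsilon> / 2 ^ n" if "t \<in> K" for n t
    using F(2) that by (simp add: dist_norm)
  define L where "L t = z0 + (\<Sum>n. F (Suc n) t - F n t)" for t
  have "uniform_limit K (\<lambda>n t. \<Sum>i<n. F (Suc i) t - F i t) (\<lambda>t. \<Sum>n. F (Suc n) t - F n t) sequentially"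
    using bound sums by (intro Weierstrass_m_test) (auto simp: sums_iff)
  then have "uniform_limit K (\<lambda>n t. z0 + (\<Sum>i<n. F (Suc i) t - F i t)) L sequentially"
    unfolding L_def by (rule uniform_limit_add[OF uniform_limit_const])
  moreover have "(\<lambda>n t. z0 + (\<Sum>i<n. F (Suc i) t - F i t)) = F"
    using sum_lessThan_telescope[of "\<lambda>i. F i t" for t] by (intro ext) (simp add: F0)
  ultimately have unif: "uniform_limit K F L sequentially"
    by simp
  have "continuous_on K L"
    by (rule uniform_limit_theorem[OF _ unif]) (use F(1) in auto)
  moreover have "L t \<in> G t" if t: "t \<in> K" for t
  proof -
    \<comment> \<open>For large \<open>n\<close> the value \<open>F n t\<close> is close both to
      \<open>L t\<close> and to \<open>G t\<close>; closedness of \<open>G t\<close> then yields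
      membership.\<close>
    have "\<exists>y\<in>G t. dist y (L t) < e" if e: "e > 0" for e
    proof -
      have "(\<lambda>n. F n t) \<longlonglongrightarrow> L t"
        using unif t by (rule tendsto_uniform_limitI)
      then have "eventually (\<lambda>n. dist (F n t) (L t) < e / 2) sequentially"
        using e by (intro tendstoD) auto
      moreover have "(\<lambda>n. 2 * \<epsilon> / 2 ^ n) \<longlonglongrightarrow> 0"
        using sums by (intro summable_LIMSEQ_zero) (auto simp: sums_iff)
      then have "eventually (\<lambda>n. 2 * \<epsilon> / 2 ^ n < e) sequentially"
        using e by (rule order_tendstoD)
      ultimately have "eventually (\<lambda>n. dist (F n t) (L t) < e / 2 \<and> 2 * \<epsilon> / 2 ^ n < e) sequentially"
        by eventually_elim simp
      then obtain n where n: "dist (F n t) (L t) < e / 2" "2 * \<epsilon> / 2 ^ n < e"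
        using eventually_happens by fastforce
      obtain y where y: "y \<in> G t" "dist (F n t) y < \<epsilon> / 2 ^ n"
        using F(1) t by blast
      have "dist y (L t) \<le> dist (F n t) y + dist (F n t) (L t)"
        by (metis dist_commute dist_triangle)
      also have "\<dots> < e"
        using n y times_divide_eq_right[of 2 \<epsilon> "2 ^ n"] by linarith
      finally show ?thesis using y by blast
    qed
    then show ?thesis
      using closed_approachable[OF cl[OF t]] by blast
  qed
  moreover have "dist (L t) z0 \<le> 4 * \<epsilon>" if t: "t \<in> K" for t
  proof -
    have "norm (\<Sum>n. F (Suc n) t - F n t) \<le> (\<Sum>n. 2 * \<epsilon> / 2 ^ n)"
      using bound[OF t] sums by (intro norm_suminf_le) (auto simp: sums_iff)
    then show ?thesis
      using sums by (simp add: L_def dist_norm sums_iff)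
  qed
  ultimately show ?thesis by blast
qed

section \<open>Admissible functions\<close>

lemma C_c_subset_C_0: "C_c V \<subseteq> C_0 V"
  unfolding C_0_def by (force intro: less_imp_le)

lemma continuous_on_C_0:
  assumes "\<phi> \<in> C_0 V"
  shows "continuous_on V \<phi>"
proof -
  have "\<exists>\<psi>\<in>C_c V. \<forall>t\<in>V. norm (\<phi> t - \<psi> t) \<le> inverse (Suc n)" for n
    using assms unfolding C_0_def by (auto simp del: of_nat_Suc)
  then obtain \<psi> where \<psi>: "\<And>n. \<psi> n \<in> C_c V"
      "\<And>n t. t \<in> V \<Longrightarrow> norm (\<phi> t - \<psi> n t) \<le> inverse (Suc n)"
    by metis
  show ?thesis
  proof (rule uniform_limit_theorem[of _ \<psi> sequentially])
    show "uniform_limit V \<psi> \<phi> sequentially"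
    proof (rule uniform_limitI)
      fix e :: real assume "e > 0"
      then have "eventually (\<lambda>n. inverse (Suc n) < e) sequentially"
        using LIMSEQ_inverse_real_of_nat by (rule order_tendstoD(2)[rotated])
      then show "eventually (\<lambda>n. \<forall>x\<in>V. dist (\<psi> n x) (\<phi> x) < e) sequentially"
        by eventually_elim (metis \<psi>(2) dist_commute dist_norm le_less_trans)
    qed
  qed (use \<psi> in \<open>auto simp: C_c_def\<close>)
qed

lemma bounded_C_0:
  assumes "\<phi> \<in> C_0 V"
  obtains B where "B \<ge> 0" "\<And>t. t \<in> V \<Longrightarrow> norm (\<phi> t) \<le> B"
proof -
  obtain \<psi> where \<psi>: "\<psi> \<in> C_c V" "\<And>t. t \<in> V \<Longrightarrow> norm (\<phi> t - \<psi> t) \<le> 1"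
    using assms unfolding C_0_def by (auto dest: spec[of _ 1])
  obtain K where K: "compact K" "K \<subseteq> V" "\<And>t. t \<in> V - K \<Longrightarrow> \<psi> t = 0" "continuous_on V \<psi>"
    using \<psi>(1) unfolding C_c_def by blast
  have "bounded (\<psi> ` K)"
    using K by (intro compact_imp_bounded compact_continuous_image) (auto intro: continuous_on_subset)
  then obtain B where B: "B > 0" "\<And>t. t \<in> K \<Longrightarrow> norm (\<psi> t) \<le> B"
    unfolding bounded_pos by auto
  have "norm (\<phi> t) \<le> B + 1" if t: "t \<in> V" for t
  proof -
    have "norm (\<psi> t) \<le> B"
      using B K(3)[of t] t by (cases "t \<in> K") auto
    then show ?thesis
      using \<psi>(2)[OF t] norm_triangle_sub[of "\<phi> t" "\<psi> t"] by linarith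
  qed
  then show ?thesis
    using B by (intro that[of "B + 1"]) auto
qed

lemma C_0_add:
  assumes "\<phi> \<in> C_0 V" "\<psi> \<in> C_0 V"
  shows "(\<lambda>t. \<phi> t + \<psi> t) \<in> C_0 V"
  unfolding C_0_def
proof safe
  fix e :: real assume "e > 0"
  then obtain \<phi>' \<psi>' where *: "\<phi>' \<in> C_c V" "\<And>t. t \<in> V \<Longrightarrow> norm (\<phi> t - \<phi>' t) \<le> e / 2"
      "\<psi>' \<in> C_c V" "\<And>t. t \<in> V \<Longrightarrow> norm (\<psi> t - \<psi>' t) \<le> e / 2"
    using assms unfolding C_0_def mem_Collect_eq by (metis half_gt_zero)
  obtain K L where K: "compact K" "K \<subseteq> V" "\<forall>t\<in>V - K. \<phi>' t = 0" "continuous_on V \<phi>'"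
    and L: "compact L" "L \<subseteq> V" "\<forall>t\<in>V - L. \<psi>' t = 0" "continuous_on V \<psi>'"
    using *(1,3) unfolding C_c_def by blast
  have "(\<lambda>t. \<phi>' t + \<psi>' t) \<in> C_c V"
    unfolding C_c_def using K L by (auto intro!: continuous_intros exI[of _ "K \<union> L"])
  moreover have "norm (\<phi> t + \<psi> t - (\<phi>' t + \<psi>' t)) \<le> e" if "t \<in> V" for t
    using norm_diff_triangle_ineq[of "\<phi> t" "\<psi> t" "\<phi>' t" "\<psi>' t"] *(2,4)[OF that] by linarith
  ultimately show "\<exists>g\<in>C_c V. \<forall>t\<in>V. norm (\<phi> t + \<psi> t - g t) \<le> e"
    by (intro bexI[of _ "\<lambda>t. \<phi>' t + \<psi>' t"]) auto
qed

lemma C_0_scaleR: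
  assumes \<phi>: "\<phi> \<in> C_0 V" and \<eta>: "continuous_on V \<eta>" "\<And>t. t \<in> V \<Longrightarrow> \<bar>\<eta> t\<bar> \<le> (1::real)"
  shows "(\<lambda>t. \<eta> t *\<^sub>R \<phi> t) \<in> C_0 V"
  unfolding C_0_def
proof safe
  fix e :: real assume "e > 0"
  then obtain \<psi> where \<psi>: "\<psi> \<in> C_c V" "\<And>t. t \<in> V \<Longrightarrow> norm (\<phi> t - \<psi> t) \<le> e"
    using \<phi> unfolding C_0_def by blast
  obtain K where K: "compact K" "K \<subseteq> V" "\<forall>t\<in>V - K. \<psi> t = 0" "continuous_on V \<psi>"
    using \<psi>(1) unfolding C_c_def by blast
  have "(\<lambda>t. \<eta> t *\<^sub>R \<psi> t) \<in> C_c V"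
    unfolding C_c_def using K \<eta> by (auto intro!: continuous_intros exI[of _ K])
  moreover have "norm (\<eta> t *\<^sub>R \<phi> t - \<eta> t *\<^sub>R \<psi> t) \<le> e" if "t \<in> V" for t
  proof -
    have "norm (\<eta> t *\<^sub>R \<phi> t - \<eta> t *\<^sub>R \<psi> t) = \<bar>\<eta> t\<bar> * norm (\<phi> t - \<psi> t)"
      by (simp add: scaleR_diff_right[symmetric])
    also have "\<dots> \<le> 1 * e"
      using \<eta>(2)[OF that] \<psi>(2)[OF that] by (intro mult_mono) auto
    finally show ?thesis by simp
  qed
  ultimately show "\<exists>g\<in>C_c V. \<forall>t\<in>V. norm (\<eta> t *\<^sub>R \<phi> t - g t) \<le> e"
    by (intro bexI[of _ "\<lambda>t. \<eta> t *\<^sub>R \<psi> t"]) auto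
qed

section \<open>Admissible functions as \<open>C_0\<close> selections of the minorants\<close>

context convex_integrand
begin

text \<open>The supremum inequality is read off pointwise in \<open>p\<close>. Where
  \<open>f t p\<close> is infinite both conditions hold trivially; elsewhere truncation is harmless
  because \<open>f t p\<close> is nonnegative.\<close>

lemma conjugate_le_iff: "conjugate f t a + ereal b \<le> 0 \<longleftrightarrow> (a, b) \<in> minorants t"
proof -
  have "conjugate f t a + ereal b \<le> 0 \<longleftrightarrow> conjugate f t a \<le> ereal (- b)"
    by (cases "conjugate f t a") auto
  also have "\<dots> \<longleftrightarrow> (\<forall>p. ereal (a \<bullet> p) - enn2ereal (f t p) \<le> ereal (- b))"
    by (simp add: conjugate_def SUP_le_iff)
  also have "\<dots> \<longleftrightarrow> (\<forall>p. ennreal ((a, b) \<bullet> (p, 1)) \<le> f t p)"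
  proof (intro iff_allI)
    fix p
    show "ereal (a \<bullet> p) - enn2ereal (f t p) \<le> ereal (- b) \<longleftrightarrow> ennreal ((a, b) \<bullet> (p, 1)) \<le> f t p"
    proof (cases "f t p")
      case (real r)
      then show ?thesis
        by (auto simp: ennreal_le_iff)
    qed simp
  qed
  finally show ?thesis
    by (simp add: minorants_def)
qed

lemma K_set_iff: "\<phi> \<in> K_set V f \<longleftrightarrow> \<phi> \<in> C_0 V \<and> (\<forall>t\<in>V. \<phi> t \<in> minorants t)"
  by (simp add: K_set_def conjugate_le_iff)

lemma zero_in_K_set: "(\<lambda>_. 0) \<in> K_set V f"
proof -
  have "(\<lambda>_. 0) \<in> C_c V"
    unfolding C_c_def by (auto intro!: exI[of _ "{}"])
  then show ?thesis
    using C_c_subset_C_0 zero_in_minorants by (auto simp: K_set_iff)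
qed

text \<open>Each \<open>minorants t\<close> is convex, so the weight may vary continuously with
  \<open>t\<close>. This is the gluing device for maxima.\<close>

lemma K_set_convex_combination:
  assumes "\<phi> \<in> K_set V f" "\<psi> \<in> K_set V f"
    and \<eta>: "continuous_on V \<eta>" "\<And>t. t \<in> V \<Longrightarrow> \<eta> t \<in> {0..1::real}"
  shows "(\<lambda>t. \<eta> t *\<^sub>R \<phi> t + (1 - \<eta> t) *\<^sub>R \<psi> t) \<in> K_set V f"
  unfolding K_set_iff
proof safe
  show "(\<lambda>t. \<eta> t *\<^sub>R \<phi> t + (1 - \<eta> t) *\<^sub>R \<psi> t) \<in> C_0 V"
    using assms(1,2) \<eta> unfolding K_set_iff
    by (intro C_0_add C_0_scaleR continuous_intros) auto
  show "\<eta> t *\<^sub>R \<phi> t + (1 - \<eta> t) *\<^sub>R \<psi> t \<in> minorants t" if "t \<in> V" for t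
    using assms(1,2) \<eta>(2) that convex_minorants[of t] unfolding K_set_iff
    by (intro convexD) auto
qed

text \<open>A selection on a compact neighbourhood of \<open>t0\<close> is multiplied by a Urysohn
  cutoff and extended by \<open>0\<close>. The product stays in the minorants because they are
  convex and contain \<open>0\<close>.\<close>

lemma K_set_through:
  assumes t0: "t0 \<in> V" and z0: "z0 \<in> minorants t0" and e: "e > 0"
  shows "\<exists>\<phi>\<in>K_set V f. dist (\<phi> t0) z0 < e"
proof -
  obtain U K where UK: "openin (top_of_set V) U" "compact K" "K \<subseteq> V" "t0 \<in> U" "U \<subseteq> K"
    using loc_compact t0 unfolding locally_compact_space_def
    by (auto simp: compactin_subtopology)
  \<comment> \<open>The selection argument loses a factor 4, and \<open>4 * (e / 5)\<close> is still
    below \<open>e\<close>.\<close>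
  obtain \<delta> where \<delta>: "\<delta> > 0"
      "\<And>s. s \<in> V \<Longrightarrow> dist s t0 < \<delta> \<Longrightarrow> \<exists>z\<in>minorants s. dist z z0 < e / 5"
    using minorants_inner_semicontinuous[OF t0 z0, of "e / 5"] e by auto
  define K' where "K' = K \<inter> cball t0 (\<delta> / 2)"
  have K': "compact K'" "K' \<subseteq> V"
    using UK by (auto simp: K'_def intro: compact_Int_closed)
  have near: "\<exists>z\<in>minorants s. dist z0 z < e / 5" if "s \<in> K'" for s
    using \<delta>(2)[of s] \<delta>(1) that K' by (auto simp: K'_def dist_commute)
  have "inner_semicontinuous_on K' minorants"
    unfolding inner_semicontinuous_on_def
  proof safe
    fix t z and \<epsilon> :: real assume "t \<in> K'" "z \<in> minorants t" "\<epsilon> > 0"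
    then show "\<exists>\<delta>>0. \<forall>s\<in>K'. dist s t < \<delta> \<longrightarrow> (\<exists>y\<in>minorants s. dist y z < \<epsilon>)"
      using minorants_inner_semicontinuous[of t z \<epsilon>] K'(2) by blast
  qed
  then obtain \<psi> where \<psi>: "continuous_on K' \<psi>"
      "\<And>t. t \<in> K' \<Longrightarrow> \<psi> t \<in> minorants t" "\<And>t. t \<in> K' \<Longrightarrow> dist (\<psi> t) z0 \<le> 4 * (e / 5)"
    using selection_near_constant[OF K'(1), of minorants z0 "e / 5"]
      convex_minorants closed_minorants near e by auto
  \<comment> \<open>The part of \<open>V\<close> off a neighbourhood of \<open>t0\<close> that is
    contained in \<open>K'\<close>. As \<open>\<eta>\<close> vanishes on \<open>T\<close>, the two
    branches of \<open>\<phi>\<close> agree on the overlap of \<open>K'\<close> and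
    \<open>T\<close>.\<close>
  define T where "T = V - U \<inter> ball t0 (\<delta> / 2)"
  have "openin (top_of_set V) (U \<inter> ball t0 (\<delta> / 2))"
    using UK(1) by (rule openin_Int_open) simp
  then have T: "closedin (top_of_set V) T"
    unfolding T_def by (metis closedin_diff closedin_topspace topspace_euclidean_subtopology)
  moreover have "closedin (top_of_set V) {t0}"
    using t0 by (intro closed_subset) auto
  moreover have "{t0} \<inter> T = {}"
    using UK \<delta> by (auto simp: T_def)
  ultimately obtain \<eta> :: "'a \<Rightarrow> real" where \<eta>: "continuous_on V \<eta>"
      "\<And>x. x \<in> V \<Longrightarrow> \<eta> x \<in> closed_segment 1 0" "\<And>x. x \<in> {t0} \<Longrightarrow> \<eta> x = 1" "\<And>x. x \<in> T \<Longrightarrow> \<eta> x = 0"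
    using Urysohn_local[of V "{t0}" T 1 0] by metis
  have \<eta>01: "\<eta> x \<in> {0..1}" if "x \<in> V" for x
    using \<eta>(2)[OF that] by (simp add: closed_segment_eq_real_ivl)
  define \<phi> where "\<phi> t = (if t \<in> K' then \<eta> t *\<^sub>R \<psi> t else 0)" for t
  have VKT: "V = K' \<union> T"
    using UK K' by (auto simp: T_def K'_def)
  have "continuous_on (K' \<union> T) (\<lambda>t. if t \<in> K' then \<eta> t *\<^sub>R \<psi> t else 0)"
  proof (rule continuous_on_cases_local)
    show "closedin (top_of_set (K' \<union> T)) K'" "closedin (top_of_set (K' \<union> T)) T"
      using T K' by (simp_all add: VKT[symmetric] closed_subset compact_imp_closed)
    show "continuous_on K' (\<lambda>t. \<eta> t *\<^sub>R \<psi> t)"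
      using \<eta>(1) \<psi>(1) K'(2) by (intro continuous_intros) (auto intro: continuous_on_subset)
  qed (use \<eta>(4) in auto)
  then have "\<phi> \<in> C_c V"
    unfolding C_c_def using K' by (auto simp: VKT[symmetric] \<phi>_def intro!: exI[of _ K'])
  then have "\<phi> \<in> C_0 V"
    using C_c_subset_C_0 by blast
  moreover have "\<phi> t \<in> minorants t" if "t \<in> V" for t
  proof (cases "t \<in> K'")
    case True
    have "\<eta> t *\<^sub>R \<psi> t + (1 - \<eta> t) *\<^sub>R 0 \<in> minorants t"
      using \<eta>01[OF that] \<psi>(2)[OF True] zero_in_minorants convex_minorants
      by (intro convexD) auto
    then show ?thesis
      using True by (simp add: \<phi>_def)
  qed (simp add: \<phi>_def zero_in_minorants)
  moreover have "t0 \<in> K'"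
    using UK \<delta> by (auto simp: K'_def)
  then have "dist (\<phi> t0) z0 < e"
    using \<psi>(3)[of t0] \<eta>(3)[of t0] e by (simp add: \<phi>_def)
  ultimately show ?thesis
    by (intro bexI[of _ \<phi>]) (auto simp: K_set_iff)
qed

end

section \<open>Integration against the density\<close>

text \<open>Lindelof is applied to the superlevel sets of each rational level, and the countable
  subfamilies are united. Comparing levels avoids suprema of reals that may be infinite.\<close>

lemma countable_subfamily_same_SUP:
  fixes u :: "'i \<Rightarrow> 'x::second_countable_topology \<Rightarrow> real"
  assumes cont: "\<And>i. i \<in> I \<Longrightarrow> continuous_on S (u i)"
  shows "\<exists>D\<subseteq>I. countable D \<and> (\<forall>x\<in>S. \<forall>i\<in>I. \<forall>c. c < u i x \<longrightarrow> (\<exists>j\<in>D. c < u j x))"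
proof -
  have "\<exists>W. open W \<and> u i -` {q<..} \<inter> S = W \<inter> S" if "i \<in> I" for i q
    using cont[OF that] open_greaterThan[of q] unfolding continuous_on_open_invariant by metis
  then obtain W where W: "\<And>i q. i \<in> I \<Longrightarrow> open (W i q)"
      "\<And>i q. i \<in> I \<Longrightarrow> u i -` {q<..} \<inter> S = W i q \<inter> S"
    by metis
  have "\<exists>D\<subseteq>I. countable D \<and> (\<Union>i\<in>D. W i q) = (\<Union>i\<in>I. W i q)" for q
  proof -
    have "\<And>S. S \<in> (\<lambda>i. W i q) ` I \<Longrightarrow> open S"
      using W(1) by blast
    then obtain F where F: "F \<subseteq> (\<lambda>i. W i q) ` I" "countable F" "\<Union>F = (\<Union>i\<in>I. W i q)"
      by (rule Lindelof)
    have "\<exists>D. countable D \<and> D \<subseteq> I \<and> F = (\<lambda>i. W i q) ` D"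
      by (rule countable_subset_image[THEN iffD1, OF conjI, OF F(2,1)])
    then obtain D where D: "countable D" "D \<subseteq> I" "F = (\<lambda>i. W i q) ` D"
      by (elim exE conjE)
    have "(\<Union>i\<in>D. W i q) = (\<Union>i\<in>I. W i q)"
      using F(3) unfolding D(3) .
    with D(1,2) show ?thesis
      by (intro exI[of _ D] conjI)
  qed
  then obtain D where D: "\<And>q. D q \<subseteq> I" "\<And>q. countable (D q)"
      "\<And>q. (\<Union>i\<in>D q. W i q) = (\<Union>i\<in>I. W i q)"
    by metis
  have "\<exists>j\<in>(\<Union>q\<in>\<rat>. D q). c < u j x" if x: "x \<in> S" and i: "i \<in> I" and c: "c < u i x" for x i c
  proof -
    obtain q where q: "q \<in> \<rat>" "c < q" "q < u i x"
      using Rats_dense_in_real[OF c] by blast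
    then have "x \<in> (\<Union>i\<in>I. W i q)"
      using W(2)[OF i, of q] x i by auto
    then obtain j where j: "j \<in> D q" "x \<in> W j q"
      using D(3) by blast
    then have "q < u j x"
      using W(2)[of j q] D(1)[of q] x by auto
    with q j show ?thesis by force
  qed
  then show ?thesis
    using countable_rat D(1,2)
    by (intro exI[of _ "\<Union>q\<in>\<rat>. D q"] conjI UN_least countable_UN ballI allI impI)
qed

section \<open>Jordan decomposition and pairing for measures given by densities\<close>

lemma ennreal_max_0_left: "ennreal (max 0 x) = ennreal x"
  by (auto simp: max_def ennreal_neg)

text \<open>The density makes the Hahn decomposition explicit: the supremum over subsets of
  \<open>A\<close> is attained where \<open>p\<close> is positive.\<close>

lemma jordan_pos_density:
  assumes sets_M: "sets M = borel_on V" and p: "integrable M p"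
    and \<mu>: "\<And>A. A \<in> borel_on V \<Longrightarrow> \<mu> A = (LINT t:A|M. p t)"
  shows "jordan_pos V \<mu> = density M (\<lambda>t. ennreal (p t))"
proof -
  let ?N = "density M (\<lambda>t. ennreal (p t))"
  have space_M: "space M = V"
    using sets_eq_imp_space_eq[OF sets_M] by (simp add: space_restrict_space)
  have [measurable]: "p \<in> borel_measurable M"
    using p by simp
  have "jordan_pos V \<mu> = measure_of V (borel_on V) (emeasure ?N)"
    unfolding jordan_pos_def
  proof (rule measure_of_eq)
    show "borel_on V \<subseteq> Pow V"
      using sets.space_closed[of M] by (simp add: sets_M space_M)
    fix A assume "A \<in> sigma_sets V (borel_on V)"
    then have A [measurable]: "A \<in> sets M"
      using sets.sigma_sets_eq[of M] by (simp add: sets_M space_M)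
    have int: "integrable M (\<lambda>t. indicator B t * p t)" if "B \<in> sets M" for B
      using integrable_mult_indicator[OF that p] by simp
    have int': "integrable M (\<lambda>t. indicator A t * max 0 (p t))"
      using integrable_mult_indicator[OF A, of "\<lambda>t. max 0 (p t)"] p by simp
    have "emeasure ?N A = (\<integral>\<^sup>+t. ennreal (indicator A t * max 0 (p t)) \<partial>M)"
      by (subst emeasure_density) (auto intro!: nn_integral_cong simp: ennreal_max_0_left split: split_indicator)
    also have "\<dots> = ennreal (\<integral>t. indicator A t * max 0 (p t) \<partial>M)"
      using int' by (intro nn_integral_eq_integral) auto
    finally have eq: "emeasure ?N A = ennreal (\<integral>t. indicator A t * max 0 (p t) \<partial>M)" .
    show "(SUP B\<in>{B \<in> borel_on V. B \<subseteq> A}. ennreal (\<mu> B)) = emeasure ?N A"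
    proof (rule antisym)
      show "(SUP B\<in>{B \<in> borel_on V. B \<subseteq> A}. ennreal (\<mu> B)) \<le> emeasure ?N A"
      proof (rule SUP_least)
        fix B assume "B \<in> {B \<in> borel_on V. B \<subseteq> A}"
        then have B: "B \<in> sets M" "B \<subseteq> A" by (auto simp: sets_M)
        have "\<mu> B = (\<integral>t. indicator B t * p t \<partial>M)"
          using \<mu>[of B] B by (simp add: sets_M set_lebesgue_integral_def)
        also have "\<dots> \<le> (\<integral>t. indicator A t * max 0 (p t) \<partial>M)"
          using B int[OF B(1)] int' by (intro integral_mono) (auto split: split_indicator)
        finally show "ennreal (\<mu> B) \<le> emeasure ?N A"
          unfolding eq by (rule ennreal_leI)
      qed
      define B where "B = {t \<in> space M. t \<in> A \<and> p t > 0}"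
      have B: "B \<in> sets M" "B \<subseteq> A" unfolding B_def by auto
      have "(\<integral>t. indicator A t * max 0 (p t) \<partial>M) = (\<integral>t. indicator B t * p t \<partial>M)"
        by (intro Bochner_Integration.integral_cong) (auto simp: B_def split: split_indicator)
      also have "\<dots> = \<mu> B"
        using \<mu>[of B] B by (simp add: sets_M set_lebesgue_integral_def)
      finally show "emeasure ?N A \<le> (SUP B\<in>{B \<in> borel_on V. B \<subseteq> A}. ennreal (\<mu> B))"
        unfolding eq using B by (intro SUP_upper2[of B]) (auto simp: sets_M)
    qed
  qed
  also have "\<dots> = ?N"
    using measure_of_of_measure[of ?N] by (simp add: sets_M space_M)
  finally show ?thesis .
qed

text \<open>The Jordan parts have the positive and the negative part of \<open>p\<close> as
  densities, and their difference is \<open>p\<close>. Boundedness of \<open>g\<close> makes both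
  integrands integrable.\<close>

lemma signed_integral_density:
  assumes sets_M: "sets M = borel_on V" and p: "integrable M p"
    and \<mu>: "\<And>A. A \<in> borel_on V \<Longrightarrow> \<mu> A = (LINT t:A|M. p t)"
    and g [measurable]: "g \<in> borel_measurable M" and B: "\<And>t. t \<in> V \<Longrightarrow> \<bar>g t\<bar> \<le> B"
  shows "signed_integral V \<mu> g = (\<integral>t. p t * g t \<partial>M)"
proof -
  have space_M: "space M = V"
    using sets_eq_imp_space_eq[OF sets_M] by (simp add: space_restrict_space)
  have part: "(LINT t|jordan_pos V \<mu>'. g t) = (\<integral>t. max 0 (p' t) * g t \<partial>M)"
      "integrable M (\<lambda>t. max 0 (p' t) * g t)"
    if p': "integrable M p'" "\<And>A. A \<in> borel_on V \<Longrightarrow> \<mu>' A = (LINT t:A|M. p' t)" for \<mu>' p'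
  proof -
    have [measurable]: "p' \<in> borel_measurable M"
      using p' by simp
    have "jordan_pos V \<mu>' = density M (\<lambda>t. ennreal (max 0 (p' t)))"
      using jordan_pos_density[OF sets_M p'] by (simp add: ennreal_max_0_left)
    then show "(LINT t|jordan_pos V \<mu>'. g t) = (\<integral>t. max 0 (p' t) * g t \<partial>M)"
      by (simp add: integral_density)
    have "AE t in M. norm (max 0 (p' t) * g t) \<le> norm (B * p' t)"
    proof (rule AE_I2)
      fix t assume "t \<in> space M"
      then have "\<bar>g t\<bar> \<le> \<bar>B\<bar>"
        using B[of t] by (auto simp: space_M)
      then have "\<bar>max 0 (p' t)\<bar> * \<bar>g t\<bar> \<le> \<bar>p' t\<bar> * \<bar>B\<bar>"
        by (intro mult_mono) auto
      then show "norm (max 0 (p' t) * g t) \<le> norm (B * p' t)"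
        by (simp add: abs_mult mult.commute)
    qed
    then show "integrable M (\<lambda>t. max 0 (p' t) * g t)"
      by (rule Bochner_Integration.integrable_bound[of M "\<lambda>t. B * p' t", rotated 2])
        (use p'(1) in auto)
  qed
  have m: "- \<mu> A = (LINT t:A|M. - p t)" if "A \<in> borel_on V" for A
    using \<mu>[OF that] by (simp add: set_lebesgue_integral_def)
  have p': "integrable M (\<lambda>t. - p t)"
    using p by simp
  note pos = part[OF p \<mu>, simplified] and neg = part[OF p' m, simplified]
  have "signed_integral V \<mu> g = (\<integral>t. max 0 (p t) * g t \<partial>M) - (\<integral>t. max 0 (- p t) * g t \<partial>M)"
    unfolding signed_integral_def pos(1) neg(1) ..
  also have "\<dots> = (\<integral>t. max 0 (p t) * g t - max 0 (- p t) * g t \<partial>M)"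
    by (rule Bochner_Integration.integral_diff[symmetric]) (rule pos neg)+
  also have "\<dots> = (\<integral>t. p t * g t \<partial>M)"
    by (intro Bochner_Integration.integral_cong) (auto simp: max_def)
  finally show ?thesis .
qed

lemma measurable_C_0:
  fixes \<phi> :: "'a::euclidean_space \<Rightarrow> 'b::euclidean_space"
  assumes "sets M = borel_on V" "\<phi> \<in> C_0 V"
  shows "\<phi> \<in> borel_measurable M"
  using borel_measurable_continuous_on_restrict[OF continuous_on_C_0[OF assms(2)]]
  by (simp add: measurable_cong_sets[OF assms(1) refl])

lemma integrable_inner_C_0:
  fixes \<phi> p :: "'a::euclidean_space \<Rightarrow> 'b::euclidean_space"
  assumes sets_M: "sets M = borel_on V" and p: "integrable M p" and \<phi>: "\<phi> \<in> C_0 V"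
  shows "integrable M (\<lambda>t. \<phi> t \<bullet> p t)"
proof -
  have space_M: "space M = V"
    using sets_eq_imp_space_eq[OF sets_M] by (simp add: space_restrict_space)
  obtain B where B: "B \<ge> 0" "\<And>t. t \<in> V \<Longrightarrow> norm (\<phi> t) \<le> B"
    using bounded_C_0[OF \<phi>] by blast
  have [measurable]: "\<phi> \<in> borel_measurable M" "p \<in> borel_measurable M"
    using measurable_C_0[OF sets_M \<phi>] p by auto
  show ?thesis
  proof (rule Bochner_Integration.integrable_bound)
    show "integrable M (\<lambda>t. B * norm (p t))"
      using p by simp
    show "AE t in M. norm (\<phi> t \<bullet> p t) \<le> norm (B * norm (p t))"
    proof (rule AE_I2)
      fix t assume "t \<in> space M"
      then have "norm (\<phi> t) * norm (p t) \<le> B * norm (p t)"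
        using B(2) by (intro mult_right_mono) (auto simp: space_M)
      then show "norm (\<phi> t \<bullet> p t) \<le> norm (B * norm (p t))"
        using Cauchy_Schwarz_ineq2[of "\<phi> t" "p t"] B(1) by (simp add: abs_mult)
    qed
  qed simp
qed

lemma pairing_density:
  fixes \<phi> p :: "'a::euclidean_space \<Rightarrow> 'b::euclidean_space"
  assumes sets_M: "sets M = borel_on V" and p: "integrable M p"
    and \<nu>: "\<And>A. A \<in> borel_on V \<Longrightarrow> \<nu> A = (LINT t:A|M. p t)"
    and \<phi>: "\<phi> \<in> C_0 V"
  shows "pairing V \<nu> \<phi> = (\<integral>t. \<phi> t \<bullet> p t \<partial>M)"
proof -
  have space_M: "space M = V"
    using sets_eq_imp_space_eq[OF sets_M] by (simp add: space_restrict_space)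
  obtain B where B: "B \<ge> 0" "\<And>t. t \<in> V \<Longrightarrow> norm (\<phi> t) \<le> B"
    using bounded_C_0[OF \<phi>] by blast
  have [measurable]: "\<phi> \<in> borel_measurable M" "p \<in> borel_measurable M"
    using measurable_C_0[OF sets_M \<phi>] p by auto
  have signed: "signed_integral V (\<lambda>A. \<nu> A \<bullet> b) (\<lambda>t. \<phi> t \<bullet> b) = (\<integral>t. (p t \<bullet> b) * (\<phi> t \<bullet> b) \<partial>M)"
    and int: "integrable M (\<lambda>t. (p t \<bullet> b) * (\<phi> t \<bullet> b))" if b: "b \<in> Basis" for b
  proof -
    have bound: "\<bar>\<phi> t \<bullet> b\<bar> \<le> B" if "t \<in> V" for t
      using Basis_le_norm[OF b, of "\<phi> t"] B(2)[OF that] by linarith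
    show "signed_integral V (\<lambda>A. \<nu> A \<bullet> b) (\<lambda>t. \<phi> t \<bullet> b) = (\<integral>t. (p t \<bullet> b) * (\<phi> t \<bullet> b) \<partial>M)"
    proof (rule signed_integral_density[OF sets_M])
      show "integrable M (\<lambda>t. p t \<bullet> b)"
        using p by simp
      show "\<nu> A \<bullet> b = (LINT t:A|M. p t \<bullet> b)" if A: "A \<in> borel_on V" for A
      proof -
        have "integrable M (\<lambda>t. indicator A t *\<^sub>R p t)"
          using A p by (intro integrable_mult_indicator) (auto simp: sets_M)
        then show ?thesis
          using \<nu>[OF A] by (simp add: set_lebesgue_integral_def flip: integral_inner_left)
      qed
    qed (use bound in auto)
    show "integrable M (\<lambda>t. (p t \<bullet> b) * (\<phi> t \<bullet> b))"
    proof (rule Bochner_Integration.integrable_bound)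
      show "integrable M (\<lambda>t. B * (p t \<bullet> b))"
        using p by simp
      show "AE t in M. norm (p t \<bullet> b * (\<phi> t \<bullet> b)) \<le> norm (B * (p t \<bullet> b))"
      proof (rule AE_I2)
        fix t assume "t \<in> space M"
        then have "\<bar>p t \<bullet> b\<bar> * \<bar>\<phi> t \<bullet> b\<bar> \<le> \<bar>p t \<bullet> b\<bar> * B"
          using bound by (intro mult_left_mono) (auto simp: space_M)
        then show "norm (p t \<bullet> b * (\<phi> t \<bullet> b)) \<le> norm (B * (p t \<bullet> b))"
          using B(1) by (simp add: abs_mult mult.commute)
      qed
    qed simp
  qed
  have "pairing V \<nu> \<phi> = (\<Sum>b\<in>Basis. \<integral>t. (p t \<bullet> b) * (\<phi> t \<bullet> b) \<partial>M)"
    unfolding pairing_def by (intro sum.cong refl signed)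
  also have "\<dots> = (\<integral>t. (\<Sum>b\<in>Basis. (p t \<bullet> b) * (\<phi> t \<bullet> b)) \<partial>M)"
    by (rule Bochner_Integration.integral_sum[symmetric]) (rule int)
  also have "\<dots> = (\<integral>t. \<phi> t \<bullet> p t \<partial>M)"
    by (intro Bochner_Integration.integral_cong refl)
      (simp add: euclidean_inner[of "\<phi> t" "p t" for t] mult.commute)
  finally show ?thesis .
qed

text \<open>The density measure is pushed forward to the Borel sets of the whole space. There it is
  a finite Borel measure, so \<open>inner_regular\<close> applies; compact subsets of
  \<open>A\<close> lie in \<open>V\<close> and keep their measure.\<close>

lemma inner_regular_density:
  fixes V :: "'a::euclidean_space set" and h :: "'a \<Rightarrow> real"
  assumes V: "V \<in> sets borel" and sets_M: "sets M = borel_on V"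
    and h: "integrable M h" and A: "A \<in> sets M" and e: "e > 0"
  shows "\<exists>K. compact K \<and> K \<subseteq> A \<and> (\<integral>\<^sup>+t. ennreal (h t) * indicator (A - K) t \<partial>M) \<le> ennreal e"
proof -
  define N where "N = density M (\<lambda>t. ennreal (h t))"
  define N' where "N' = distr N borel (\<lambda>t. t)"
  have space_M: "space M = V"
    using sets_eq_imp_space_eq[OF sets_M] by (simp add: space_restrict_space)
  have [measurable]: "h \<in> borel_measurable M"
    using h by simp
  have sets_borel: "B \<in> sets borel \<and> B \<subseteq> V" if "B \<in> sets M" for B
    using that V by (auto simp: sets_M sets_restrict_space)
  have sets_M': "B \<in> sets M" if "B \<in> sets borel" "B \<subseteq> V" for B
    using that V by (force simp: sets_M sets_restrict_space)
  have id: "(\<lambda>t. t) \<in> N \<rightarrow>\<^sub>M borel"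
  proof (subst measurable_cong_sets[of N "restrict_space borel V" borel borel])
    show "(\<lambda>t. t) \<in> restrict_space borel V \<rightarrow>\<^sub>M borel"
      by (rule measurable_restrict_space1) simp
  qed (auto simp: N_def sets_M)
  have N': "emeasure N' B = emeasure N B" if "B \<in> sets borel" "B \<subseteq> V" for B
  proof -
    have "(\<lambda>t. t) -` B \<inter> space N = B"
      using that by (auto simp: N_def space_M)
    then show ?thesis
      using that by (simp add: N'_def emeasure_distr[OF id])
  qed
  have fin: "emeasure N (space N) < \<infinity>"
  proof -
    have "emeasure N (space N) = (\<integral>\<^sup>+t. ennreal (h t) \<partial>M)"
      unfolding N_def by (subst emeasure_density) (auto intro!: nn_integral_cong)
    also have "\<dots> \<le> (\<integral>\<^sup>+t. ennreal (norm (h t)) \<partial>M)"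
      by (intro nn_integral_mono ennreal_leI) simp
    also have "\<dots> < \<infinity>"
      using h by (simp add: integrable_iff_bounded)
    finally show ?thesis .
  qed
  have fin': "emeasure N' (space N') \<noteq> \<infinity>"
    using fin by (simp add: N'_def emeasure_distr[OF id])
  have finA: "emeasure N' A \<noteq> \<infinity>"
    using emeasure_mono[of A "space N'" N'] fin' sets_borel[OF A]
    by (auto simp: N'_def top_unique)
  have "emeasure N' A = (SUP K\<in>{K. K \<subseteq> A \<and> compact K}. emeasure N' K)"
    using fin' sets_borel[OF A] by (intro inner_regular) (auto simp: N'_def)
  then have "\<exists>K\<in>{K. K \<subseteq> A \<and> compact K}. emeasure N' A < emeasure N' K + ennreal e"
    using e finA by (intro SUP_approx_ennreal) auto
  then obtain K where K: "K \<subseteq> A" "compact K" "emeasure N' A < emeasure N' K + ennreal e"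
    by auto
  have KV: "K \<in> sets borel" "K \<subseteq> V"
    using K sets_borel[OF A] by (auto intro: borel_compact)
  have K_M: "K \<in> sets M"
    using KV by (rule sets_M')
  have eqs: "emeasure N' A = emeasure N A" "emeasure N' K = emeasure N K"
    using N' KV sets_borel[OF A] by auto
  have lt: "emeasure N A < emeasure N K + ennreal e"
    using K(3) unfolding eqs .
  have "emeasure N K \<le> emeasure N A"
    using K(1) A by (intro emeasure_mono) (auto simp: N_def)
  then have finK: "emeasure N K \<noteq> \<infinity>"
    using finA unfolding eqs by (auto simp: top_unique)
  have "(\<integral>\<^sup>+t. ennreal (h t) * indicator (A - K) t \<partial>M) = emeasure N (A - K)"
    unfolding N_def using A K_M by (subst emeasure_density) auto
  also have "\<dots> = emeasure N A - emeasure N K"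
    using A K_M K(1) finK by (intro emeasure_Diff) (auto simp: N_def)
  also have "\<dots> \<le> ennreal e"
    using lt finK by (simp add: ennreal_minus_le_iff less_imp_le)
  finally show ?thesis
    using K by blast
qed

section \<open>Interchange of supremum and integral\<close>

locale convex_integrand_density = convex_integrand V f
  for V :: "'a::euclidean_space set" and f :: "'a \<Rightarrow> 'm::euclidean_space \<Rightarrow> ennreal" +
  fixes M :: "'a measure" and p :: "'a \<Rightarrow> 'm \<times> real"
  assumes sets_M: "sets M = borel_on V" and p: "integrable M p"
begin

lemma space_M: "space M = V"
  using sets_eq_imp_space_eq[OF sets_M] by (simp add: space_restrict_space)

text \<open>A locally compact subset of a Euclidean space is the intersection of a closed and an
  open set.\<close>

lemma V_borel: "V \<in> sets borel"
proof -
  have "locally compact V"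
    unfolding locally_compact
  proof
    fix x assume "x \<in> V"
    then obtain U K where "openin (top_of_set V) U" "compact K" "K \<subseteq> V" "x \<in> U" "U \<subseteq> K"
      using loc_compact unfolding locally_compact_space_def by (auto simp: compactin_subtopology)
    then show "\<exists>u v. x \<in> u \<and> u \<subseteq> v \<and> v \<subseteq> V \<and> openin (top_of_set V) u \<and> compact v"
      by blast
  qed
  then obtain C W where "closed C" "open W" "V = C \<inter> W"
    unfolding locally_compact_closed_Int_open by blast
  then show ?thesis by auto
qed

text \<open>The weight \<open>\<eta>\<close> is 1 on a compact part of the set where
  \<open>\<phi>\<close> wins and 0 on a compact part of its complement. Elsewhere the error is
  dominated by \<open>h\<close>, whose integral there is small.\<close>

lemma K_set_max:
  assumes \<phi>: "\<phi> \<in> K_set V f" and \<psi>: "\<psi> \<in> K_set V f" and e: "e > 0"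
  shows "\<exists>g\<in>K_set V f.
    (\<integral>\<^sup>+t. ennreal \<bar>g t \<bullet> p t - max (\<phi> t \<bullet> p t) (\<psi> t \<bullet> p t)\<bar> \<partial>M) \<le> ennreal e"
proof -
  have C0: "\<phi> \<in> C_0 V" "\<psi> \<in> C_0 V"
    using \<phi> \<psi> by (auto simp: K_set_iff)
  have [measurable]: "\<phi> \<in> borel_measurable M" "\<psi> \<in> borel_measurable M" "p \<in> borel_measurable M"
    using measurable_C_0[OF sets_M] C0 p by auto
  obtain a where a: "a \<ge> 0" "\<And>t. t \<in> V \<Longrightarrow> norm (\<phi> t) \<le> a"
    using bounded_C_0[OF C0(1)] by blast
  obtain b where b: "b \<ge> 0" "\<And>t. t \<in> V \<Longrightarrow> norm (\<psi> t) \<le> b"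
    using bounded_C_0[OF C0(2)] by blast
  define h where "h t = (a + b) * norm (p t)" for t
  have h: "integrable M h"
    unfolding h_def using p by simp
  then have [measurable]: "h \<in> borel_measurable M" by simp
  define A where "A = {t \<in> space M. \<psi> t \<bullet> p t \<le> \<phi> t \<bullet> p t}"
  have A: "A \<in> sets M" "space M - A \<in> sets M"
    unfolding A_def by auto
  obtain K where K: "compact K" "K \<subseteq> A" "(\<integral>\<^sup>+t. ennreal (h t) * indicator (A - K) t \<partial>M) \<le> ennreal (e / 2)"
    using inner_regular_density[OF V_borel sets_M h A(1), of "e / 2"] e by auto
  obtain L where L: "compact L" "L \<subseteq> space M - A"
      "(\<integral>\<^sup>+t. ennreal (h t) * indicator (space M - A - L) t \<partial>M) \<le> ennreal (e / 2)"
    using inner_regular_density[OF V_borel sets_M h A(2), of "e / 2"] e by auto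
  have KL_V: "K \<subseteq> V" "L \<subseteq> V"
    using K L by (auto simp: A_def space_M)
  have meas: "K \<in> sets M" "L \<in> sets M"
    using K(1) L(1) KL_V by (force simp: sets_M sets_restrict_space intro: borel_compact)+
  have "closedin (top_of_set V) K" "closedin (top_of_set V) L" "K \<inter> L = {}"
    using K L KL_V by (auto intro: closed_subset compact_imp_closed)
  then obtain \<eta> :: "'a \<Rightarrow> real" where \<eta>: "continuous_on V \<eta>"
      "\<And>x. x \<in> V \<Longrightarrow> \<eta> x \<in> closed_segment 1 0" "\<And>x. x \<in> K \<Longrightarrow> \<eta> x = 1" "\<And>x. x \<in> L \<Longrightarrow> \<eta> x = 0"
    using Urysohn_local[of V K L 1 0] by metis
  have \<eta>01: "\<eta> x \<in> {0..1}" if "x \<in> V" for x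
    using \<eta>(2)[OF that] by (simp add: closed_segment_eq_real_ivl)
  define g where "g t = \<eta> t *\<^sub>R \<phi> t + (1 - \<eta> t) *\<^sub>R \<psi> t" for t
  have "g \<in> K_set V f"
    unfolding g_def by (rule K_set_convex_combination[OF \<phi> \<psi> \<eta>(1) \<eta>01])
  moreover have "(\<integral>\<^sup>+t. ennreal \<bar>g t \<bullet> p t - max (\<phi> t \<bullet> p t) (\<psi> t \<bullet> p t)\<bar> \<partial>M) \<le>
      (\<integral>\<^sup>+t. ennreal (h t) * indicator (A - K) t + ennreal (h t) * indicator (space M - A - L) t \<partial>M)"
  proof (rule nn_integral_mono)
    fix t assume t: "t \<in> space M"
    let ?x = "\<phi> t \<bullet> p t" and ?y = "\<psi> t \<bullet> p t"
    have g: "g t \<bullet> p t = \<eta> t * ?x + (1 - \<eta> t) * ?y"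
      by (simp add: g_def inner_add_left)
    consider "t \<in> K" | "t \<in> L" | "t \<in> A - K" | "t \<in> space M - A - L"
      using t by blast
    then show "ennreal \<bar>g t \<bullet> p t - max ?x ?y\<bar> \<le>
      ennreal (h t) * indicator (A - K) t + ennreal (h t) * indicator (space M - A - L) t"
    proof cases
      case 1
      then show ?thesis using K(2) by (auto simp: g \<eta>(3) A_def max_def)
    next
      case 2
      then show ?thesis using L(2) by (auto simp: g \<eta>(4) A_def max_def)
    next
      \<comment> \<open>Off \<open>K\<close> and \<open>L\<close> the value
        \<open>g t \<bullet> p t\<close> is a convex combination of \<open>?x\<close> and
        \<open>?y\<close>, so it differs from their maximum by at most
        \<open>\<bar>?x - ?y\<bar>\<close>. The estimate serves both remaining cases.\<close>
      have \<eta>t: "0 \<le> \<eta> t" "\<eta> t \<le> 1"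
        using \<eta>01[of t] t by (auto simp: space_M)
      have "\<bar>?x\<bar> \<le> a * norm (p t)" "\<bar>?y\<bar> \<le> b * norm (p t)"
        using a(2)[of t] b(2)[of t] t
        by (auto simp: space_M intro!: order_trans[OF Cauchy_Schwarz_ineq2] mult_right_mono)
      then have d: "\<bar>?x - ?y\<bar> \<le> h t"
        unfolding h_def distrib_right by linarith
      have "\<bar>g t \<bullet> p t - max ?x ?y\<bar> \<le> \<bar>?x - ?y\<bar>"
      proof (cases "?x \<ge> ?y")
        case True
        have "g t \<bullet> p t - max ?x ?y = (1 - \<eta> t) * (?y - ?x)"
          using True by (simp add: g algebra_simps)
        moreover have "\<bar>(1 - \<eta> t) * (?y - ?x)\<bar> \<le> 1 * \<bar>?y - ?x\<bar>"
          using \<eta>t unfolding abs_mult by (intro mult_right_mono) auto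
        ultimately show ?thesis by simp
      next
        case False
        have "g t \<bullet> p t - max ?x ?y = \<eta> t * (?x - ?y)"
          using False by (simp add: g algebra_simps)
        moreover have "\<bar>\<eta> t * (?x - ?y)\<bar> \<le> 1 * \<bar>?x - ?y\<bar>"
          using \<eta>t unfolding abs_mult by (intro mult_right_mono) auto
        ultimately show ?thesis by simp
      qed
      with d have le: "ennreal \<bar>g t \<bullet> p t - max ?x ?y\<bar> \<le> ennreal (h t)"
        by (intro ennreal_leI) linarith
      {
        case 3
        then show ?thesis using le by simp
      next
        case 4
        then show ?thesis using le by simp
      }
    qed
  qed
  moreover have "\<dots> \<le> ennreal (e / 2) + ennreal (e / 2)"
    using K(3) L(3) A meas by (subst nn_integral_add) (auto intro: add_mono)
  moreover have "ennreal (e / 2) + ennreal (e / 2) = ennreal e"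
    using e by (simp flip: ennreal_plus)
  ultimately show ?thesis
    by (intro bexI[of _ g]) auto
qed

text \<open>Half of the error is spent on the maximum of the first functions, half on gluing in the
  next one. The errors add because \<open>max\<close> is nonexpansive in its first argument.\<close>

lemma K_set_Max:
  fixes \<phi> :: "nat \<Rightarrow> 'a \<Rightarrow> 'm \<times> real"
  assumes \<phi>: "\<And>j. \<phi> j \<in> K_set V f" and e: "e > 0"
  shows "\<exists>g\<in>K_set V f. (\<integral>\<^sup>+t. ennreal \<bar>g t \<bullet> p t - Max ((\<lambda>j. \<phi> j t \<bullet> p t) ` {..n})\<bar> \<partial>M) \<le> ennreal e"
  using e
proof (induction n arbitrary: e)
  case 0
  show ?case
    by (intro bexI[of _ "\<phi> 0"] \<phi>) simp
next
  case (Suc n)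
  let ?m = "\<lambda>t. Max ((\<lambda>j. \<phi> j t \<bullet> p t) ` {..n})" and ?x = "\<lambda>t. \<phi> (Suc n) t \<bullet> p t"
  have meas [measurable]: "\<psi> \<in> borel_measurable M" if "\<psi> \<in> K_set V f" for \<psi>
    using that measurable_C_0[OF sets_M] by (auto simp: K_set_iff)
  have [measurable]: "p \<in> borel_measurable M" "\<And>j. \<phi> j \<in> borel_measurable M"
    using p \<phi> meas by auto
  obtain g where g: "g \<in> K_set V f" "(\<integral>\<^sup>+t. ennreal \<bar>g t \<bullet> p t - ?m t\<bar> \<partial>M) \<le> ennreal (e / 2)"
    using Suc.IH[of "e / 2"] Suc.prems by auto
  obtain g' where g': "g' \<in> K_set V f"
      "(\<integral>\<^sup>+t. ennreal \<bar>g' t \<bullet> p t - max (g t \<bullet> p t) (?x t)\<bar> \<partial>M) \<le> ennreal (e / 2)"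
    using K_set_max[OF g(1) \<phi>, of "e / 2" "Suc n"] Suc.prems by auto
  note [measurable] = meas[OF g(1)] meas[OF g'(1)]
  have Max_Suc: "Max ((\<lambda>j. \<phi> j t \<bullet> p t) ` {..Suc n}) = max (?m t) (?x t)" for t
    by (simp add: atMost_Suc max.commute)
  have "(\<integral>\<^sup>+t. ennreal \<bar>g' t \<bullet> p t - Max ((\<lambda>j. \<phi> j t \<bullet> p t) ` {..Suc n})\<bar> \<partial>M) \<le>
      (\<integral>\<^sup>+t. ennreal \<bar>g' t \<bullet> p t - max (g t \<bullet> p t) (?x t)\<bar> + ennreal \<bar>g t \<bullet> p t - ?m t\<bar> \<partial>M)"
    unfolding Max_Suc by (intro nn_integral_mono) (auto simp flip: ennreal_plus intro!: ennreal_leI)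
  also have "\<dots> = (\<integral>\<^sup>+t. ennreal \<bar>g' t \<bullet> p t - max (g t \<bullet> p t) (?x t)\<bar> \<partial>M) +
      (\<integral>\<^sup>+t. ennreal \<bar>g t \<bullet> p t - ?m t\<bar> \<partial>M)"
    by (rule nn_integral_add) auto
  also have "\<dots> \<le> ennreal (e / 2) + ennreal (e / 2)"
    by (intro add_mono g g')
  also have "\<dots> = ennreal e"
    using Suc.prems by (simp flip: ennreal_plus)
  finally show ?case
    using g'(1) by blast
qed

text \<open>Treating \<open>t\<close> and \<open>w\<close> as one variable in
  \<open>V \<times> UNIV\<close> gives a countable family that serves all directions at once. The
  zero function in front will make the finite maxima nonnegative.\<close>

lemma countable_K_set:
  "\<exists>\<phi> :: nat \<Rightarrow> 'a \<Rightarrow> 'm \<times> real. (\<forall>j. \<phi> j \<in> K_set V f) \<and> \<phi> 0 = (\<lambda>_. 0) \<and>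
    (\<forall>t\<in>V. \<forall>w. support t w = (SUP j. ennreal (\<phi> j t \<bullet> w)))"
proof -
  have "\<exists>D\<subseteq>K_set V f. countable D \<and>
      (\<forall>x\<in>V \<times> UNIV. \<forall>\<phi>\<in>K_set V f. \<forall>c. c < \<phi> (fst x) \<bullet> snd x \<longrightarrow> (\<exists>\<psi>\<in>D. c < \<psi> (fst x) \<bullet> snd x))"
  proof (rule countable_subfamily_same_SUP)
    fix \<phi> assume "\<phi> \<in> K_set V f"
    then have "continuous_on V \<phi>"
      using continuous_on_C_0 by (auto simp: K_set_iff)
    then show "continuous_on (V \<times> UNIV) (\<lambda>x. \<phi> (fst x) \<bullet> snd x)"
      by (auto intro!: continuous_intros intro: continuous_on_compose2)
  qed
  then obtain D where D: "D \<subseteq> K_set V f" "countable D"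
      "\<And>t w \<phi> c. t \<in> V \<Longrightarrow> \<phi> \<in> K_set V f \<Longrightarrow> c < \<phi> t \<bullet> w \<Longrightarrow> \<exists>\<psi>\<in>D. c < \<psi> t \<bullet> w"
    by (metis SigmaI UNIV_I fst_conv snd_conv)
  \<comment> \<open>Inserting the zero function ensures nonemptiness, which
    \<open>range_from_nat_into\<close> requires.\<close>
  define D' where "D' = insert (\<lambda>_. 0) D"
  define \<phi> where "\<phi> j = (case j of 0 \<Rightarrow> (\<lambda>_. 0) | Suc i \<Rightarrow> from_nat_into D' i)" for j
  have range: "range (from_nat_into D') = D'"
    using D(2) by (intro range_from_nat_into) (auto simp: D'_def)
  have D'K: "D' \<subseteq> K_set V f"
    using D(1) zero_in_K_set by (auto simp: D'_def)
  have \<phi>K: "\<phi> j \<in> K_set V f" for j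
    using range D'K zero_in_K_set by (auto simp: \<phi>_def split: nat.split)
  have sup: "support t w = (SUP j. ennreal (\<phi> j t \<bullet> w))" if t: "t \<in> V" for t w
  proof (rule antisym)
    show "(SUP j. ennreal (\<phi> j t \<bullet> w)) \<le> support t w"
      using \<phi>K t by (intro SUP_least inner_le_support) (auto simp: K_set_iff)
    show "support t w \<le> (SUP j. ennreal (\<phi> j t \<bullet> w))"
      unfolding support_def
    proof (rule SUP_least, rule dense_le)
      fix z y assume z: "z \<in> minorants t" and y: "y < ennreal (z \<bullet> w)"
      then obtain c where c: "y = ennreal c" "c \<ge> 0" by (cases y) auto
      then have cz: "c < z \<bullet> w"
        using y by (simp add: ennreal_less_iff)
      \<comment> \<open>By Cauchy--Schwarz, replacing \<open>z\<close> by a point at distance less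
        than \<open>e\<close> costs at most \<open>e * norm w\<close>, less than the gap
        \<open>z \<bullet> w - c\<close>; the summand 1 covers \<open>w = 0\<close>.\<close>
      define e where "e = (z \<bullet> w - c) / (norm w + 1)"
      have e: "e > 0" "e * (norm w + 1) = z \<bullet> w - c"
        using cz by (auto simp: e_def add_nonneg_pos intro!: divide_pos_pos)
          (metis add_nonneg_eq_0_iff norm_ge_zero zero_le_one zero_neq_one)
      obtain \<psi> where \<psi>: "\<psi> \<in> K_set V f" "dist (\<psi> t) z < e"
        using K_set_through[OF t z e(1)] by blast
      have "(z - \<psi> t) \<bullet> w \<le> norm (z - \<psi> t) * norm w"
        by (rule norm_cauchy_schwarz)
      also have "\<dots> \<le> e * norm w"
        using \<psi>(2) by (intro mult_right_mono) (auto simp: dist_norm norm_minus_commute)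
      also have "\<dots> < e * (norm w + 1)"
        using e(1) by simp
      finally have "c < \<psi> t \<bullet> w"
        using e(2) by (simp add: inner_diff_left)
      then obtain \<psi>' where \<psi>': "\<psi>' \<in> D" "c < \<psi>' t \<bullet> w"
        using D(3)[OF t \<psi>(1)] by blast
      then obtain i where "\<psi>' = from_nat_into D' i"
        using range by (auto simp: D'_def)
      then have "\<psi>' = \<phi> (Suc i)"
        by (simp add: \<phi>_def)
      then show "y \<le> (SUP j. ennreal (\<phi> j t \<bullet> w))"
        using \<psi>'(2) c by (intro SUP_upper2[of "Suc i"]) (auto intro: ennreal_leI)
    qed
  qed
  show ?thesis
    using \<phi>K sup by (intro exI[of _ \<phi>]) (simp add: \<phi>_def)
qed

text \<open>One inequality is pointwise. For the other, monotone convergence along the finite maxima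
  \<open>m n\<close> reduces the claim to their integrals, which \<open>K_set_Max\<close>
  approximates by single admissible functions.\<close>

lemma nn_integral_support:
  "enn2ereal (\<integral>\<^sup>+t. support t (p t) \<partial>M) = (SUP \<phi>\<in>K_set V f. ereal (\<integral>t. \<phi> t \<bullet> p t \<partial>M))"
    (is "enn2ereal ?I = ?S")
proof (rule antisym)
  have int: "integrable M (\<lambda>t. \<psi> t \<bullet> p t)" if "\<psi> \<in> K_set V f" for \<psi>
    using that integrable_inner_C_0[OF sets_M p] by (auto simp: K_set_iff)
  show "?S \<le> enn2ereal ?I"
  proof (rule SUP_least)
    fix \<phi> assume \<phi>: "\<phi> \<in> K_set V f"
    have "ennreal (\<integral>t. \<phi> t \<bullet> p t \<partial>M) \<le> ennreal (\<integral>t. max 0 (\<phi> t \<bullet> p t) \<partial>M)"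
      using int[OF \<phi>] by (intro ennreal_leI integral_mono) auto
    also have "\<dots> = (\<integral>\<^sup>+t. ennreal (max 0 (\<phi> t \<bullet> p t)) \<partial>M)"
      using int[OF \<phi>] by (intro nn_integral_eq_integral[symmetric]) auto
    also have "\<dots> \<le> ?I"
      unfolding ennreal_max_0_left using \<phi>
      by (intro nn_integral_mono inner_le_support) (simp add: K_set_iff space_M)
    finally have "enn2ereal (ennreal (\<integral>t. \<phi> t \<bullet> p t \<partial>M)) \<le> enn2ereal ?I"
      by (simp add: less_eq_ennreal.rep_eq)
    \<comment> \<open>The integral of an admissible function may be negative; truncation can only
      increase it.\<close>
    moreover have "ereal x \<le> enn2ereal (ennreal x)" for x
      by (cases "x \<ge> 0") (auto simp: ennreal_neg zero_ennreal.rep_eq)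
    ultimately show "ereal (\<integral>t. \<phi> t \<bullet> p t \<partial>M) \<le> enn2ereal ?I"
      using order_trans by blast
  qed
  obtain \<phi> :: "nat \<Rightarrow> 'a \<Rightarrow> 'm \<times> real" where \<phi>: "\<And>j. \<phi> j \<in> K_set V f" "\<phi> 0 = (\<lambda>_. 0)"
      "\<And>t w. t \<in> V \<Longrightarrow> support t w = (SUP j. ennreal (\<phi> j t \<bullet> w))"
    using countable_K_set by metis
  define m where "m n t = Max ((\<lambda>j. \<phi> j t \<bullet> p t) ` {..n})" for n t
  have m_ge: "\<phi> j t \<bullet> p t \<le> m n t" if "j \<le> n" for j n t
    unfolding m_def using that by (intro Max_ge) auto
  have m_nonneg: "0 \<le> m n t" for n t
    using m_ge[of 0 n t] by (simp add: \<phi>(2))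
  have m_eq: "\<exists>j\<le>n. m n t = \<phi> j t \<bullet> p t" for n t
  proof -
    have "m n t \<in> (\<lambda>j. \<phi> j t \<bullet> p t) ` {..n}"
      unfolding m_def by (rule Max_in) auto
    then show ?thesis by auto
  qed
  have int_m: "integrable M (m n)" for n
  proof (induction n)
    case 0
    then show ?case using int[OF \<phi>(1)] by (simp add: m_def)
  next
    case (Suc n)
    have "m (Suc n) = (\<lambda>t. max (\<phi> (Suc n) t \<bullet> p t) (m n t))"
      by (auto simp: m_def atMost_Suc)
    then show ?case using int[OF \<phi>(1)] Suc by simp
  qed
  have bound: "ereal (integral\<^sup>L M (m n)) \<le> ?S" for n
  proof (rule ereal_le_epsilon2)
    fix e :: real assume "e > 0"
    then have "\<exists>g\<in>K_set V f. (\<integral>\<^sup>+t. ennreal \<bar>g t \<bullet> p t - m n t\<bar> \<partial>M) \<le> ennreal e"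
      unfolding m_def by (intro K_set_Max \<phi>(1))
    then obtain g where g: "g \<in> K_set V f" "(\<integral>\<^sup>+t. ennreal \<bar>g t \<bullet> p t - m n t\<bar> \<partial>M) \<le> ennreal e"
      by (elim bexE)
    have int_g: "integrable M (\<lambda>t. \<bar>g t \<bullet> p t - m n t\<bar>)"
      using int[OF g(1)] int_m by simp
    then have "ennreal (\<integral>t. \<bar>g t \<bullet> p t - m n t\<bar> \<partial>M) \<le> ennreal e"
      using g(2) by (subst (asm) nn_integral_eq_integral) auto
    then have le: "(\<integral>t. \<bar>g t \<bullet> p t - m n t\<bar> \<partial>M) \<le> e"
      using \<open>e > 0\<close> by simp
    have "integral\<^sup>L M (m n) \<le> (\<integral>t. g t \<bullet> p t + \<bar>g t \<bullet> p t - m n t\<bar> \<partial>M)"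
      using int[OF g(1)] int_m int_g by (intro integral_mono) auto
    also have "\<dots> = (\<integral>t. g t \<bullet> p t \<partial>M) + (\<integral>t. \<bar>g t \<bullet> p t - m n t\<bar> \<partial>M)"
      using int[OF g(1)] int_g by simp
    also have "\<dots> \<le> (\<integral>t. g t \<bullet> p t \<partial>M) + e"
      using le by simp
    finally have "ereal (integral\<^sup>L M (m n)) \<le> ereal (\<integral>t. g t \<bullet> p t \<partial>M) + ereal e"
      by simp
    also have "\<dots> \<le> ?S + ereal e"
      using g(1) by (intro add_right_mono SUP_upper)
    finally show "ereal (integral\<^sup>L M (m n)) \<le> ?S + ereal e" .
  qed
  \<comment> \<open>The function \<open>0\<close> is admissible. Hence the truncation by
    \<open>e2ennreal\<close> does not change \<open>?S\<close>, and the final conversion back is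
    exact.\<close>
  have S_nonneg: "0 \<le> ?S"
    using zero_in_K_set by (intro SUP_upper2[of "\<lambda>_. 0"]) (auto simp: zero_ereal_def)
  have "?I = (\<integral>\<^sup>+t. (SUP n. ennreal (m n t)) \<partial>M)"
  proof (rule nn_integral_cong)
    fix t assume "t \<in> space M"
    then have "support t (p t) = (SUP j. ennreal (\<phi> j t \<bullet> p t))"
      by (intro \<phi>(3)) (simp add: space_M)
    also have "\<dots> = (SUP n. ennreal (m n t))"
    proof (rule antisym)
      show "(SUP j. ennreal (\<phi> j t \<bullet> p t)) \<le> (SUP n. ennreal (m n t))"
        by (intro SUP_mono) (use m_ge ennreal_leI in blast)
      show "(SUP n. ennreal (m n t)) \<le> (SUP j. ennreal (\<phi> j t \<bullet> p t))"
        by (intro SUP_mono) (use m_eq[of _ t] in \<open>metis order_refl UNIV_I\<close>)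
    qed
    finally show "support t (p t) = (SUP n. ennreal (m n t))" .
  qed
  also have "\<dots> = (SUP n. \<integral>\<^sup>+t. ennreal (m n t) \<partial>M)"
  proof (rule nn_integral_monotone_convergence_SUP)
    show "incseq (\<lambda>n t. ennreal (m n t))"
    proof (rule incseq_SucI, rule le_funI)
      fix n t
      have "m n t \<le> m (Suc n) t"
        unfolding m_def by (intro Max_mono) auto
      then show "ennreal (m n t) \<le> ennreal (m (Suc n) t)"
        by (rule ennreal_leI)
    qed
    show "(\<lambda>t. ennreal (m n t)) \<in> borel_measurable M" for n
      using int_m[of n] by simp
  qed
  also have "\<dots> \<le> e2ennreal ?S"
  proof (rule SUP_least)
    fix n
    have "(\<integral>\<^sup>+t. ennreal (m n t) \<partial>M) = ennreal (integral\<^sup>L M (m n))"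
      using int_m m_nonneg by (intro nn_integral_eq_integral) auto
    also have "\<dots> = e2ennreal (ereal (integral\<^sup>L M (m n)))"
      by (simp add: ennreal_def e2ennreal_def)
    also have "\<dots> \<le> e2ennreal ?S"
      using bound by (rule e2ennreal_mono)
    finally show "(\<integral>\<^sup>+t. ennreal (m n t) \<partial>M) \<le> e2ennreal ?S" .
  qed
  finally have "enn2ereal ?I \<le> enn2ereal (e2ennreal ?S)"
    by (simp add: less_eq_ennreal.rep_eq)
  then show "enn2ereal ?I \<le> ?S"
    using S_nonneg by (simp add: enn2ereal_e2ennreal)
qed

end

section \<open>Application to the total variation measure and its polar density\<close>

lemma sets_total_variation: "sets (total_variation V \<nu>) = borel_on V"
proof -
  have "borel_on V \<subseteq> Pow V"
    using sets.space_closed[of "restrict_space borel V"] by (simp add: space_restrict_space)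
  then have "sets (total_variation V \<nu>) = sigma_sets V (borel_on V)"
    by (simp add: total_variation_def)
  also have "\<dots> = borel_on V"
    using sets.sigma_sets_eq[of "restrict_space borel V"] by (simp add: space_restrict_space)
  finally show ?thesis .
qed

theorem theorem4:
  fixes V :: "(real ^ 'n) set"
    and f :: "real ^ 'n \<Rightarrow> real ^ 'm \<Rightarrow> ennreal"
    and \<nu> :: "(real ^ 'n) set \<Rightarrow> (real ^ 'm) \<times> real"
    and p_xi :: "real ^ 'n \<Rightarrow> real ^ 'm"
    and p_lam :: "real ^ 'n \<Rightarrow> real"
  assumes "locally_compact_space (top_of_set V)"
    and "lower_semicontinuous_on (V \<times> UNIV) (\<lambda>(t, x). f t x)"
    and "\<And>t. t \<in> V \<Longrightarrow> convex_ennreal (f t)"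
    and "locally_bounded_on V (\<lambda>t. f t 0)"
    and "\<nu> \<in> radon_measures V"
    and "polar_density V \<nu> (\<lambda>t. (p_xi t, p_lam t))"
  shows "benamou_brenier V f \<nu> =
    enn2ereal (\<integral>\<^sup>+ t. perspective f t (p_xi t) (p_lam t) \<partial>total_variation V \<nu>)"
proof -
  let ?M = "total_variation V \<nu>" and ?p = "\<lambda>t. (p_xi t, p_lam t)"
  interpret convex_integrand_density V f ?M ?p
    using assms by unfold_locales (auto simp: polar_density_def sets_total_variation)
  have "pairing V \<nu> \<phi> = (\<integral>t. \<phi> t \<bullet> ?p t \<partial>?M)" if "\<phi> \<in> K_set V f" for \<phi>
    using that assms(6) sets_M p by (intro pairing_density) (auto simp: polar_density_def K_set_iff)
  then have "benamou_brenier V f \<nu> = (SUP \<phi>\<in>K_set V f. ereal (\<integral>t. \<phi> t \<bullet> ?p t \<partial>?M))"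
    unfolding benamou_brenier_def by (intro SUP_cong) auto
  also have "\<dots> = enn2ereal (\<integral>\<^sup>+t. support t (?p t) \<partial>?M)"
    by (rule nn_integral_support[symmetric])
  also have "(\<integral>\<^sup>+t. support t (?p t) \<partial>?M) = (\<integral>\<^sup>+ t. perspective f t (p_xi t) (p_lam t) \<partial>?M)"
    by (intro nn_integral_cong) (simp add: perspective_eq_support space_M)
  finally show ?thesis .
qed

end
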